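(* Let $E$ be a complex Banach lattice and let $(e^{tA})_{t\ge0}$ be a real, uniformly eventually positive, and persistently irreducible $C_0$-semigroup on $E$. If the spectral bound $s(A)$ is a pole of the resolvent $\mathcal R(\cdot,A)$ and the rescaled semigroup $(e^{t(A-s(A))})_{t\ge0}$ is bounded, then every element of the peripheral spectrum $\sigma_{\mathrm{per}}(A)$ is an eigenvalue of $A$.
   Context: $s(A):=\sup\{\operatorname{Re}\lambda:\lambda\in\sigma(A)\}$; $\sigma_{\mathrm{per}}(A):=\{\lambda\in\sigma(A):\operatorname{Re}\lambda=s(A)\}$. A bounded operator on a complex Banach lattice is real if it maps the real part $E_{\mathbb R}$ into itself; a semigroup is real if each $e^{tA}$ is real. The semigroup is uniformly eventually positive if there is $t_0\ge0$ such that $e^{tA}f\ge0$ for all $t\ge t_0$ and all $0\le f\in E$. A (lattice) ideal of $E$ is a subspace $I$ such that $|y|\le|x|$, $x\in I$ implies $y\in I$. The semigroup is persistently irreducible if, whenever $I$ is a closed ideal of $E$ for which there exists $t_0\ge0$ with $e^{tA}I\subseteq I$ for all $t\ge t_0$, one has $I=\{0\}$ or $I=E$. *)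

theory Defs
  imports "HOL-Analysis.Analysis" "HOL-Library.Lattice_Algebras"
begin

section \<open>Real Banach lattices\<close>

class banach_lattice = lattice_ab_group_add_abs + ordered_real_vector + banach +
  assumes norm_mono_abs: "\<bar>x\<bar> \<le> \<bar>y\<bar> \<Longrightarrow> norm x \<le> norm y"

instance real :: banach_lattice
  by standard (auto simp: sup_real_def)

lemma norm_mono_nonneg:
  fixes x y :: "'a::banach_lattice"
  assumes "0 \<le> x" "x \<le> y"
  shows "norm x \<le> norm y"
proof -
  have "\<bar>x\<bar> \<le> \<bar>y\<bar>"
    using assms order.trans[OF assms] by (simp add: abs_of_nonneg)
  then show ?thesis by (rule norm_mono_abs)
qed

lemma norm_abs_lattice [simp]:
  fixes x :: "'a::banach_lattice"
  shows "norm \<bar>x\<bar> = norm x"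
  by (intro order.antisym norm_mono_abs) simp_all

lemma le_abs_lattice: "x \<le> \<bar>x\<bar>" "- x \<le> \<bar>x\<bar>" for x :: "'a::banach_lattice"
  by (auto simp: abs_lattice)

lemma limit_le_lattice:
  fixes v m :: "'a::banach_lattice"
  assumes lim: "X \<longlonglongrightarrow> m" and le: "\<And>n. X n \<le> v"
  shows "m \<le> v"
proof -
  define w where "w = sup (m - v) 0"
  have w0: "0 \<le> w" by (simp add: w_def)
  have "norm w \<le> norm (m - X n)" for n
  proof -
    have "m - v \<le> m - X n" using le[of n] by simp
    then have "m - v \<le> \<bar>m - X n\<bar>" using le_abs_lattice(1) order.trans by blast
    then have "w \<le> \<bar>m - X n\<bar>" by (simp add: w_def)
    then show ?thesis using norm_mono_nonneg[OF w0] by fastforce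
  qed
  moreover have "(\<lambda>n. norm (m - X n)) \<longlonglongrightarrow> norm (m - m)"
    by (intro tendsto_intros lim)
  ultimately have "norm w \<le> 0"
    using LIMSEQ_le_const[of "\<lambda>n. norm (m - X n)" 0 "norm w"] by auto
  then have "sup (m - v) 0 = 0" by (simp add: w_def)
  then have "m - v \<le> 0" by (metis sup.cobounded1)
  then show ?thesis by simp
qed

lemma limit_ge_lattice:
  fixes v m :: "'a::banach_lattice"
  assumes lim: "X \<longlonglongrightarrow> m" and le: "\<And>n. v \<le> X n"
  shows "v \<le> m"
proof -
  have "- m \<le> - v"
    by (rule limit_le_lattice[of "\<lambda>n. - X n"]) (auto intro!: tendsto_intros lim le)
  then show ?thesis by simp
qed

definition is_lub :: "'a::order set \<Rightarrow> 'a \<Rightarrow> bool" where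
  "is_lub S m \<longleftrightarrow> (\<forall>s\<in>S. s \<le> m) \<and> (\<forall>u. (\<forall>s\<in>S. s \<le> u) \<longrightarrow> m \<le> u)"

lemma is_lub_unique: "is_lub S m \<Longrightarrow> is_lub S m' \<Longrightarrow> m = m'"
  unfolding is_lub_def by (meson order.antisym)

lemma is_lub_approx:
  fixes S :: "'a::banach_lattice set"
  assumes e: "0 \<le> e"
    and upper: "\<And>n u. (\<forall>s\<in>S. s \<le> u) \<Longrightarrow> X n \<le> u"
    and approx: "\<And>n s. s \<in> S \<Longrightarrow> s \<le> X n + (1/2)^n *\<^sub>R e"
  shows "\<exists>m. is_lub S m"
proof -
  have step: "X p \<le> X n + (1/2)^n *\<^sub>R e" for n p
    using upper approx by blast
  have close: "norm (X p - X n) \<le> (1/2)^n * norm e" if "n \<le> p" for n p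
  proof -
    have "X p - X n \<le> (1/2)^n *\<^sub>R e"
      using step[of p n] by (simp add: algebra_simps)
    moreover have "- (X p - X n) \<le> (1/2)^n *\<^sub>R e"
    proof -
      have "- (X p - X n) \<le> (1/2)^p *\<^sub>R e"
        using step[of n p] by (simp add: algebra_simps)
      also have "\<dots> \<le> (1/2)^n *\<^sub>R e"
        using that e by (intro scaleR_right_mono power_decreasing) auto
      finally show ?thesis .
    qed
    ultimately have "\<bar>X p - X n\<bar> \<le> (1/2)^n *\<^sub>R e" by (simp add: abs_lattice)
    then have "norm \<bar>X p - X n\<bar> \<le> norm ((1/2)^n *\<^sub>R e)"
      by (intro norm_mono_nonneg) auto
    then show ?thesis by simp
  qed
  have lim0: "(\<lambda>n. (1/2::real)^n) \<longlonglongrightarrow> 0" by (rule LIMSEQ_power_zero) simp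
  then have limN: "(\<lambda>n. (1/2::real)^n * norm e) \<longlonglongrightarrow> 0"
    using tendsto_mult_right[of "\<lambda>n. (1/2::real)^n" 0 sequentially "norm e"] by simp
  have "Cauchy X"
  proof (rule CauchyI)
    fix r :: real assume "0 < r"
    then obtain N where N: "(1/2)^N * norm e < r"
      using order_tendstoD(2)[OF limN] by (auto simp: eventually_sequentially)
    have *: "norm (X p - X n) < r" if "N \<le> n" "n \<le> p" for n p
    proof -
      have "norm (X p - X n) \<le> (1/2)^n * norm e" using close that by simp
      also have "\<dots> \<le> (1/2)^N * norm e"
        using that by (intro mult_right_mono power_decreasing) auto
      finally show ?thesis using N by simp
    qed
    have "norm (X p - X n) < r" if "N \<le> n" "N \<le> p" for n p
    proof (cases "n \<le> p")
      case True
      then show ?thesis using * that by blast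
    next
      case False
      then have "norm (X n - X p) < r" using *[of p n] that by simp
      then show ?thesis by (simp add: norm_minus_commute)
    qed
    then show "\<exists>M. \<forall>m\<ge>M. \<forall>n\<ge>M. norm (X m - X n) < r" by blast
  qed
  then obtain m where m: "X \<longlonglongrightarrow> m"
    using Cauchy_convergent convergent_def by blast
  have "(\<lambda>n. X n + (1/2)^n *\<^sub>R e) \<longlonglongrightarrow> m + 0 *\<^sub>R e"
    by (intro tendsto_intros m lim0)
  then have "s \<le> m" if "s \<in> S" for s
    using limit_ge_lattice[of "\<lambda>n. X n + (1/2)^n *\<^sub>R e" m s] approx that by auto
  moreover have "m \<le> u" if "\<forall>s\<in>S. s \<le> u" for u
    using limit_le_lattice[OF m] upper that by blast
  ultimately show ?thesis unfolding is_lub_def by blast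
qed


section \<open>Complex Banach spaces\<close>

class scaleC =
  fixes scaleC :: "complex \<Rightarrow> 'a \<Rightarrow> 'a" (infixr \<open>*\<^sub>C\<close> 75)

class complex_banach = banach + scaleC +
  assumes scaleC_add_right: "c *\<^sub>C (x + y) = c *\<^sub>C x + c *\<^sub>C y"
    and scaleC_add_left: "(c + d) *\<^sub>C x = c *\<^sub>C x + d *\<^sub>C x"
    and scaleC_scaleC: "c *\<^sub>C d *\<^sub>C x = (c * d) *\<^sub>C x"
    and scaleR_eq_scaleC: "r *\<^sub>R x = complex_of_real r *\<^sub>C x"
    and norm_scaleC: "norm (c *\<^sub>C x) = cmod c * norm x"

definition csubspace :: "'a::complex_banach set \<Rightarrow> bool" where
  "csubspace V \<longleftrightarrow> 0 \<in> V \<and> (\<forall>x\<in>V. \<forall>y\<in>V. x + y \<in> V) \<and> (\<forall>c. \<forall>x\<in>V. c *\<^sub>C x \<in> V)"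

definition bounded_clinear :: "('a::complex_banach \<Rightarrow> 'a) \<Rightarrow> bool" where
  "bounded_clinear T \<longleftrightarrow> bounded_linear T \<and> (\<forall>c x. T (c *\<^sub>C x) = c *\<^sub>C T x)"


section \<open>Complex Banach lattices\<close>

text \<open>
  A complex Banach lattice is the complexification \<open>E = E\<^sub>\<real> + \<i> E\<^sub>\<real>\<close> of a real Banach
  lattice \<open>E\<^sub>\<real>\<close>, with modulus \<open>\<bar>x + \<i> y\<bar> = sup {(cos \<theta>) x + (sin \<theta>) y | \<theta>}\<close> and norm
  \<open>\<parallel>z\<parallel> = \<parallel> \<bar>z\<bar> \<parallel>\<close>. The supremum exists although \<open>E\<^sub>\<real>\<close> need not be order complete
  (\<open>is_lub_modulus\<close> below).
\<close>

datatype 'a complexification = Complexify (re_part: 'a) (im_part: 'a)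

definition rotations :: "'a::banach_lattice complexification \<Rightarrow> 'a set" where
  "rotations z = range (\<lambda>\<theta>. cos \<theta> *\<^sub>R re_part z + sin \<theta> *\<^sub>R im_part z)"

definition modulus :: "'a::banach_lattice complexification \<Rightarrow> 'a" where
  "modulus z = (THE m. is_lub (rotations z) m)"

lemma scaleR_le_abs: "r *\<^sub>R x \<le> \<bar>r\<bar> *\<^sub>R \<bar>x\<bar>" for x :: "'a::banach_lattice"
proof (cases "0 \<le> r")
  case True
  then show ?thesis by (simp add: scaleR_left_mono le_abs_lattice)
next
  case False
  have "(- r) *\<^sub>R (- x) \<le> (- r) *\<^sub>R \<bar>x\<bar>"
    using False by (intro scaleR_left_mono le_abs_lattice) auto
  then show ?thesis using False by simp
qed

lemma is_lub_modulus_ex: "\<exists>m. is_lub (rotations z) m" for z :: "'a::banach_lattice complexification"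
proof -
  define x y where "x = re_part z" and "y = im_part z"
  define e where "e = \<bar>x\<bar> + \<bar>y\<bar>"
  define g where "g c = Re c *\<^sub>R x + Im c *\<^sub>R y" for c
  have e0: "0 \<le> e" by (simp add: e_def)
  have rot: "rotations z = g ` sphere 0 1"
  proof -
    have "sphere 0 1 = range cis"
    proof (intro set_eqI iffI)
      fix c :: complex assume "c \<in> sphere 0 1"
      then have "c = cis (Arg c)" by (metis cis_Arg dist_0_norm div_by_1 mem_sphere
            norm_zero sgn_div_norm inverse_1 scaleR_one zero_neq_one)
      then show "c \<in> range cis" by blast
    qed auto
    then show ?thesis by (simp add: rotations_def g_def x_def y_def image_image)
  qed
  have lip: "g c \<le> g d + cmod (c - d) *\<^sub>R e" for c d
  proof -
    have "g c - g d = Re (c - d) *\<^sub>R x + Im (c - d) *\<^sub>R y"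
      by (simp add: g_def algebra_simps)
    also have "\<dots> \<le> \<bar>Re (c - d)\<bar> *\<^sub>R \<bar>x\<bar> + \<bar>Im (c - d)\<bar> *\<^sub>R \<bar>y\<bar>"
      by (intro add_mono scaleR_le_abs)
    also have "\<dots> \<le> cmod (c - d) *\<^sub>R \<bar>x\<bar> + cmod (c - d) *\<^sub>R \<bar>y\<bar>"
      using abs_Re_le_cmod[of "c - d"] abs_Im_le_cmod[of "c - d"]
      by (intro add_mono scaleR_right_mono) auto
    finally show ?thesis by (simp add: e_def algebra_simps)
  qed
  have "\<exists>k. finite k \<and> k \<subseteq> sphere 0 1 \<and> sphere (0::complex) 1 \<subseteq> (\<Union>c\<in>k. ball c ((1/2)^n))" for n
    by (rule seq_compact_imp_totally_bounded[rule_format])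
       (auto simp: compact_imp_seq_compact)
  then have "\<exists>K. \<forall>n. finite (K n) \<and> K n \<subseteq> sphere 0 1 \<and>
      sphere (0::complex) 1 \<subseteq> (\<Union>c\<in>K n. ball c ((1/2)^n))"
    by (intro choice allI)
  then obtain K where K: "\<And>n. finite (K n)" "\<And>n. K n \<subseteq> sphere 0 1"
      "\<And>n. sphere (0::complex) 1 \<subseteq> (\<Union>c\<in>K n. ball c ((1/2)^n))"
    by blast
  have "(1::complex) \<in> sphere 0 1" by simp
  then have Kne: "K n \<noteq> {}" for n using K(3)[of n] by blast
  show ?thesis
  proof (rule is_lub_approx[where X = "\<lambda>n. Sup_fin (g ` K n)", OF e0])
    fix n u assume "\<forall>s\<in>rotations z. s \<le> u"
    then show "Sup_fin (g ` K n) \<le> u"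
      using K(1,2) Kne by (intro Sup_fin.boundedI) (auto simp: rot)
  next
    fix n s assume "s \<in> rotations z"
    then obtain c where c: "c \<in> sphere 0 1" "s = g c" by (auto simp: rot)
    then obtain d where d: "d \<in> K n" "c \<in> ball d ((1/2)^n)" using K(3)[of n] by blast
    have "cmod (c - d) \<le> (1/2)^n"
      using d(2) by (simp add: dist_norm norm_minus_commute)
    then have "cmod (c - d) *\<^sub>R e \<le> (1/2)^n *\<^sub>R e" using e0 by (rule scaleR_right_mono)
    then have "s \<le> g d + (1/2)^n *\<^sub>R e"
      using order.trans[OF lip[of c d] add_left_mono] c(2) by blast
    also have "g d \<le> Sup_fin (g ` K n)" using d(1) K(1) by (intro Sup_fin.coboundedI) auto
    finally show "s \<le> Sup_fin (g ` K n) + (1/2)^n *\<^sub>R e" by simp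
  qed
qed

lemma is_lub_modulus: "is_lub (rotations z) (modulus z)"
proof -
  obtain m where "is_lub (rotations z) m" using is_lub_modulus_ex by blast
  then show ?thesis
    unfolding modulus_def by (rule theI) (use is_lub_unique \<open>is_lub (rotations z) m\<close> in blast)
qed

lemma modulus_upper: "cos \<theta> *\<^sub>R re_part z + sin \<theta> *\<^sub>R im_part z \<le> modulus z"
  using is_lub_modulus[of z] by (auto simp: is_lub_def rotations_def)

lemma modulus_least:
  "(\<And>\<theta>. cos \<theta> *\<^sub>R re_part z + sin \<theta> *\<^sub>R im_part z \<le> u) \<Longrightarrow> modulus z \<le> u"
  using is_lub_modulus[of z] by (auto simp: is_lub_def rotations_def)

lemma abs_re_le_modulus: "\<bar>re_part z\<bar> \<le> modulus z"
  using modulus_upper[of 0 z] modulus_upper[of pi z] by (simp add: abs_lattice)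

lemma abs_im_le_modulus: "\<bar>im_part z\<bar> \<le> modulus z"
  using modulus_upper[of "pi/2" z] modulus_upper[of "- (pi/2)" z] by (simp add: abs_lattice)

lemma modulus_nonneg [simp]: "0 \<le> modulus z"
  using abs_re_le_modulus[of z] order.trans[OF abs_ge_zero] by blast

lemma modulus_le: "modulus z \<le> \<bar>re_part z\<bar> + \<bar>im_part z\<bar>"
proof (rule modulus_least)
  fix \<theta>
  have *: "r *\<^sub>R x \<le> \<bar>x\<bar>" if "\<bar>r\<bar> \<le> 1" for r and x :: 'a
    using order.trans[OF scaleR_le_abs[of r x] scaleR_right_mono[OF that, of "\<bar>x\<bar>"]] by simp
  show "cos \<theta> *\<^sub>R re_part z + sin \<theta> *\<^sub>R im_part z \<le> \<bar>re_part z\<bar> + \<bar>im_part z\<bar>"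
    by (intro add_mono *) auto
qed

instantiation complexification :: (banach_lattice) "{zero, plus, uminus, minus, scaleR, scaleC, norm}"
begin

definition "0 = Complexify 0 0"
definition "z + w = Complexify (re_part z + re_part w) (im_part z + im_part w)"
definition "- z = Complexify (- re_part z) (- im_part z)"
definition "z - w = Complexify (re_part z - re_part w) (im_part z - im_part w)"
definition "r *\<^sub>R z = Complexify (r *\<^sub>R re_part z) (r *\<^sub>R im_part z)"
definition "c *\<^sub>C z = Complexify (Re c *\<^sub>R re_part z - Im c *\<^sub>R im_part z)
                                (Re c *\<^sub>R im_part z + Im c *\<^sub>R re_part z)"
definition "norm z = norm (modulus z)"

instance ..

end

instantiation complexification :: (banach_lattice) real_normed_vector
begin

definition sgn_complexification_def: "sgn z = z /\<^sub>R norm z" for z :: "'a complexification"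
definition dist_complexification_def: "dist z w = norm (z - w)" for z :: "'a complexification"
definition uniformity_complexification_def: "(uniformity :: ('a complexification \<times> 'a complexification) filter) =
  (INF e\<in>{0 <..}. principal {(z, w). dist z w < e})"
definition open_complexification_def: "open U \<longleftrightarrow> (\<forall>z\<in>U. eventually (\<lambda>(z', w). z' = z \<longrightarrow> w \<in> U) uniformity)"
  for U :: "'a complexification set"

lemma parts_simps [simp]:
  "re_part (0 :: 'a complexification) = 0" "im_part (0 :: 'a complexification) = 0"
  "re_part (z + w) = re_part z + re_part w" "im_part (z + w) = im_part z + im_part w"
  "re_part (- z) = - re_part z" "im_part (- z) = - im_part z"
  "re_part (z - w) = re_part z - re_part w" "im_part (z - w) = im_part z - im_part w"
  "re_part (r *\<^sub>R z) = r *\<^sub>R re_part z" "im_part (r *\<^sub>R z) = r *\<^sub>R im_part z"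
  "re_part (c *\<^sub>C z) = Re c *\<^sub>R re_part z - Im c *\<^sub>R im_part z"
  "im_part (c *\<^sub>C z) = Re c *\<^sub>R im_part z + Im c *\<^sub>R re_part z"
  for z w :: "'a complexification"
  by (simp_all add: zero_complexification_def plus_complexification_def uminus_complexification_def
      minus_complexification_def scaleR_complexification_def scaleC_complexification_def)

lemma complexification_eqI: "re_part z = re_part w \<Longrightarrow> im_part z = im_part w \<Longrightarrow> z = w"
  for z w :: "'a complexification"
  by (rule complexification.expand) simp

lemma modulus_add: "modulus (z + w) \<le> modulus z + modulus w" for z w :: "'a complexification"
proof (rule modulus_least)
  fix \<theta>
  show "cos \<theta> *\<^sub>R re_part (z + w) + sin \<theta> *\<^sub>R im_part (z + w) \<le> modulus z + modulus w"
    using add_mono[OF modulus_upper[of \<theta> z] modulus_upper[of \<theta> w]] by (simp add: algebra_simps)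
qed

lemma modulus_scaleC_le: "modulus (c *\<^sub>C z) \<le> cmod c *\<^sub>R modulus z" for z :: "'a complexification"
proof (rule modulus_least)
  fix \<theta>
  define r \<phi> where "r = cmod c" and "\<phi> = Arg c"
  have "c = rcis r \<phi>" by (simp add: r_def \<phi>_def rcis_cmod_Arg)
  then have c: "Re c = r * cos \<phi>" "Im c = r * sin \<phi>" by simp_all
  have "cos \<theta> *\<^sub>R re_part (c *\<^sub>C z) + sin \<theta> *\<^sub>R im_part (c *\<^sub>C z)
      = r *\<^sub>R (cos (\<theta> - \<phi>) *\<^sub>R re_part z + sin (\<theta> - \<phi>) *\<^sub>R im_part z)"
    by (simp add: c cos_diff sin_diff algebra_simps)
  also have "\<dots> \<le> r *\<^sub>R modulus z"
    by (intro scaleR_left_mono modulus_upper) (simp add: r_def)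
  finally show "cos \<theta> *\<^sub>R re_part (c *\<^sub>C z) + sin \<theta> *\<^sub>R im_part (c *\<^sub>C z) \<le> cmod c *\<^sub>R modulus z"
    by (simp add: r_def)
qed

lemma norm_parts_le:
  "norm (re_part z) \<le> norm z" "norm (im_part z) \<le> norm z"
  "norm z \<le> norm (re_part z) + norm (im_part z)"
  for z :: "'a complexification"
proof -
  show "norm (re_part z) \<le> norm z"
    using norm_mono_nonneg[OF _ abs_re_le_modulus[of z]] by (simp add: norm_complexification_def)
  show "norm (im_part z) \<le> norm z"
    using norm_mono_nonneg[OF _ abs_im_le_modulus[of z]] by (simp add: norm_complexification_def)
  have "norm z \<le> norm (\<bar>re_part z\<bar> + \<bar>im_part z\<bar>)"
    using norm_mono_nonneg[OF _ modulus_le[of z]] by (simp add: norm_complexification_def)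
  also have "\<dots> \<le> norm (re_part z) + norm (im_part z)"
    using norm_triangle_ineq[of "\<bar>re_part z\<bar>" "\<bar>im_part z\<bar>"] by simp
  finally show "norm z \<le> norm (re_part z) + norm (im_part z)" .
qed

lemma scaleC_scaleC_aux: "c *\<^sub>C d *\<^sub>C z = (c * d) *\<^sub>C z" for z :: "'a complexification"
  by (rule complexification_eqI) (simp_all add: algebra_simps)

lemma norm_scaleC_le: "norm (c *\<^sub>C z) \<le> cmod c * norm z" for z :: "'a complexification"
  using norm_mono_nonneg[OF _ modulus_scaleC_le[of c z]] by (simp add: norm_complexification_def)

lemma norm_scaleC_aux: "norm (c *\<^sub>C z) = cmod c * norm z" for z :: "'a complexification"
proof (cases "c = 0")
  case True
  have "norm (c *\<^sub>C z) \<le> 0" using norm_scaleC_le[of c z] True by simp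
  moreover have "0 \<le> norm (c *\<^sub>C z)" by (simp add: norm_complexification_def)
  ultimately show ?thesis using True by simp
next
  case False
  have "1 *\<^sub>C z = z" by (rule complexification_eqI) simp_all
  then have "norm z = norm (inverse c *\<^sub>C c *\<^sub>C z)"
    using False by (simp add: scaleC_scaleC_aux)
  also have "\<dots> \<le> inverse (cmod c) * norm (c *\<^sub>C z)"
    using norm_scaleC_le[of "inverse c" "c *\<^sub>C z"] by (simp add: norm_inverse)
  finally have "cmod c * norm z \<le> norm (c *\<^sub>C z)"
    using False by (simp add: field_simps)
  with norm_scaleC_le[of c z] show ?thesis by simp
qed

lemma scaleR_scaleC_aux: "r *\<^sub>R z = complex_of_real r *\<^sub>C z" for z :: "'a complexification"
  by (rule complexification_eqI) simp_all

instance
proof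
  fix x y z :: "'a complexification" and a b :: real
  show "x + y + z = x + (y + z)" "x + y = y + x" "0 + x = x" "- x + x = 0" "x - y = x + - y"
    "a *\<^sub>R (x + y) = a *\<^sub>R x + a *\<^sub>R y" "(a + b) *\<^sub>R x = a *\<^sub>R x + b *\<^sub>R x"
    "a *\<^sub>R b *\<^sub>R x = (a * b) *\<^sub>R x" "1 *\<^sub>R x = x"
    by (auto intro!: complexification_eqI simp: algebra_simps)
  show "norm (a *\<^sub>R x) = \<bar>a\<bar> * norm x" by (simp add: scaleR_scaleC_aux norm_scaleC_aux)
  show "norm x = 0 \<longleftrightarrow> x = 0"
  proof
    assume "norm x = 0"
    then have "re_part x = 0" "im_part x = 0" using norm_parts_le(1,2)[of x] by simp_all
    then show "x = 0" by (intro complexification_eqI) simp_all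
  next
    assume "x = 0"
    then have "norm x \<le> 0" using norm_parts_le(3)[of x] by simp
    then show "norm x = 0" by (simp add: norm_complexification_def)
  qed
  have "norm (modulus (x + y)) \<le> norm (modulus x + modulus y)"
    by (intro norm_mono_nonneg modulus_add) simp
  also have "\<dots> \<le> norm x + norm y"
    by (simp add: norm_complexification_def norm_triangle_ineq)
  finally show "norm (x + y) \<le> norm x + norm y" by (simp add: norm_complexification_def)
  show "sgn x = x /\<^sub>R norm x" by (rule sgn_complexification_def)
  show "dist x y = norm (x - y)" by (rule dist_complexification_def)
  show "(uniformity :: ('a complexification \<times> 'a complexification) filter) =
      (INF e\<in>{0 <..}. principal {(z, w). dist z w < e})"
    by (rule uniformity_complexification_def)
  show "open U \<longleftrightarrow> (\<forall>x\<in>U. \<forall>\<^sub>F (x', y) in uniformity. x' = x \<longrightarrow> y \<in> U)"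
    for U :: "'a complexification set"
    by (rule open_complexification_def)
qed

end

lemma Cauchy_parts_aux:
  assumes "Cauchy X" "\<And>m n. norm (Y m - Y n) \<le> norm (X m - X n)"
  shows "Cauchy Y"
  using assms unfolding Cauchy_iff by (meson order.strict_trans1)

instance complexification :: (banach_lattice) banach
proof
  fix X :: "nat \<Rightarrow> 'a complexification"
  assume cauchy: "Cauchy X"
  have "Cauchy (\<lambda>n. re_part (X n))"
    by (rule Cauchy_parts_aux[OF cauchy]) (metis norm_parts_le(1) parts_simps(7))
  moreover have "Cauchy (\<lambda>n. im_part (X n))"
    by (rule Cauchy_parts_aux[OF cauchy]) (metis norm_parts_le(2) parts_simps(8))
  ultimately obtain x y where x: "(\<lambda>n. re_part (X n)) \<longlonglongrightarrow> x" and y: "(\<lambda>n. im_part (X n)) \<longlonglongrightarrow> y"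
    using Cauchy_convergent convergent_def by metis
  have "(\<lambda>n. norm (re_part (X n) - x) + norm (im_part (X n) - y)) \<longlonglongrightarrow> norm (x - x) + norm (y - y)"
    by (intro tendsto_intros x y)
  then have *: "(\<lambda>n. norm (re_part (X n) - x) + norm (im_part (X n) - y)) \<longlonglongrightarrow> 0" by simp
  have "(\<lambda>n. X n - Complexify x y) \<longlonglongrightarrow> 0"
  proof (rule Lim_null_comparison[OF _ *], rule always_eventually, rule allI)
    show "norm (X n - Complexify x y) \<le> norm (re_part (X n) - x) + norm (im_part (X n) - y)" for n
      using norm_parts_le(3)[of "X n - Complexify x y"] by simp
  qed
  then have "X \<longlonglongrightarrow> Complexify x y"
    by (simp add: LIM_zero_iff)
  then show "convergent X" by (auto simp: convergent_def)
qed

instance complexification :: (banach_lattice) complex_banach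
proof
  fix x y :: "'a complexification" and c d :: complex and r :: real
  show "c *\<^sub>C (x + y) = c *\<^sub>C x + c *\<^sub>C y" "(c + d) *\<^sub>C x = c *\<^sub>C x + d *\<^sub>C x"
    by (auto intro!: complexification_eqI simp: algebra_simps)
qed (rule scaleC_scaleC_aux scaleR_scaleC_aux norm_scaleC_aux)+

definition real_part_space :: "'a::banach_lattice complexification set" where
  "real_part_space = {z. im_part z = 0}"

definition nonneg :: "'a::banach_lattice complexification \<Rightarrow> bool" where
  "nonneg z \<longleftrightarrow> z \<in> real_part_space \<and> 0 \<le> re_part z"

definition lattice_ideal :: "'a::banach_lattice complexification set \<Rightarrow> bool" where
  "lattice_ideal I \<longleftrightarrow> csubspace I \<and> (\<forall>x\<in>I. \<forall>y. modulus y \<le> modulus x \<longrightarrow> y \<in> I)"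

definition real_operator ::
    "('a::banach_lattice complexification \<Rightarrow> 'a complexification) \<Rightarrow> bool" where
  "real_operator T \<longleftrightarrow> T ` real_part_space \<subseteq> real_part_space"


section \<open>Unbounded operators and their spectra\<close>

text \<open>
  A linear operator on \<open>E\<close> is given by its domain \<open>D\<close> and a map \<open>A\<close>, whose values outside \<open>D\<close>
  are irrelevant.
\<close>

definition resolvent ::
    "'a::complex_banach set \<Rightarrow> ('a \<Rightarrow> 'a) \<Rightarrow> complex \<Rightarrow> 'a \<Rightarrow> 'a" where
  "resolvent D A \<mu> = inv_into D (\<lambda>x. \<mu> *\<^sub>C x - A x)"

definition resolvent_set :: "'a::complex_banach set \<Rightarrow> ('a \<Rightarrow> 'a) \<Rightarrow> complex set" where
  "resolvent_set D A =
     {\<mu>. bij_betw (\<lambda>x. \<mu> *\<^sub>C x - A x) D UNIV \<and> bounded_clinear (resolvent D A \<mu>)}"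

definition op_spectrum :: "'a::complex_banach set \<Rightarrow> ('a \<Rightarrow> 'a) \<Rightarrow> complex set" where
  "op_spectrum D A = - resolvent_set D A"

definition spectral_bound :: "'a::complex_banach set \<Rightarrow> ('a \<Rightarrow> 'a) \<Rightarrow> ereal" where
  "spectral_bound D A = (SUP \<mu>\<in>op_spectrum D A. ereal (Re \<mu>))"

definition peripheral_spectrum :: "'a::complex_banach set \<Rightarrow> ('a \<Rightarrow> 'a) \<Rightarrow> complex set" where
  "peripheral_spectrum D A = {\<mu> \<in> op_spectrum D A. ereal (Re \<mu>) = spectral_bound D A}"

definition is_eigenvalue :: "'a::complex_banach set \<Rightarrow> ('a \<Rightarrow> 'a) \<Rightarrow> complex \<Rightarrow> bool" where
  "is_eigenvalue D A \<mu> \<longleftrightarrow> (\<exists>x\<in>D. x \<noteq> 0 \<and> A x = \<mu> *\<^sub>C x)"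

text \<open>
  \<open>\<mu>\<^sub>0\<close> is a pole (of order \<open>m \<ge> 1\<close>) of the resolvent if on a punctured disc around \<open>\<mu>\<^sub>0\<close> the resolvent
  exists and has a Laurent expansion \<open>(\<Sum>n. (\<mu> - \<mu>\<^sub>0)\<^bsup>n - m\<^esup> U\<^sub>n)\<close> in operator norm with \<open>U\<^sub>0 \<noteq> 0\<close>.
  The library predicate \<open>is_pole\<close> is not suitable for operator-valued functions: the norm of the
  resolvent tends to infinity at every isolated spectral value, also at essential singularities.
\<close>

definition resolvent_pole :: "'a::complex_banach set \<Rightarrow> ('a \<Rightarrow> 'a) \<Rightarrow> complex \<Rightarrow> bool" where
  "resolvent_pole D A \<mu>\<^sub>0 \<longleftrightarrow>
     (\<exists>r>0. \<exists>m\<ge>1. \<exists>U :: nat \<Rightarrow> 'a \<Rightarrow> 'a.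
        (\<forall>n. bounded_clinear (U n)) \<and> U 0 \<noteq> (\<lambda>x. 0) \<and>
        (\<forall>\<mu>. 0 < cmod (\<mu> - \<mu>\<^sub>0) \<and> cmod (\<mu> - \<mu>\<^sub>0) < r \<longrightarrow>
           \<mu> \<in> resolvent_set D A \<and>
           (\<lambda>N. onorm (\<lambda>x. resolvent D A \<mu> x -
                  (\<Sum>n<N. ((\<mu> - \<mu>\<^sub>0) powi (int n - int m)) *\<^sub>C U n x))) \<longlonglongrightarrow> 0))"


section \<open>Operator semigroups\<close>

text \<open>A semigroup \<open>(T t)\<^bsub>t \<ge> 0\<^esub>\<close> is a function on the reals whose values at \<open>t < 0\<close> are irrelevant.\<close>

definition C0_semigroup :: "(real \<Rightarrow> 'a::complex_banach \<Rightarrow> 'a) \<Rightarrow> bool" where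
  "C0_semigroup T \<longleftrightarrow>
     (\<forall>t\<ge>0. bounded_clinear (T t)) \<and> T 0 = id \<and>
     (\<forall>s\<ge>0. \<forall>t\<ge>0. T (s + t) = T s \<circ> T t) \<and>
     (\<forall>x. ((\<lambda>t. T t x) \<longlongrightarrow> x) (at_right 0))"

definition is_generator ::
    "'a::complex_banach set \<Rightarrow> ('a \<Rightarrow> 'a) \<Rightarrow> (real \<Rightarrow> 'a \<Rightarrow> 'a) \<Rightarrow> bool" where
  "is_generator D A T \<longleftrightarrow>
     D = {x. \<exists>y. ((\<lambda>t. (T t x - x) /\<^sub>R t) \<longlongrightarrow> y) (at_right 0)} \<and>
     (\<forall>x\<in>D. ((\<lambda>t. (T t x - x) /\<^sub>R t) \<longlongrightarrow> A x) (at_right 0))"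

definition bounded_semigroup :: "(real \<Rightarrow> 'a::complex_banach \<Rightarrow> 'a) \<Rightarrow> bool" where
  "bounded_semigroup T \<longleftrightarrow> (\<exists>M. \<forall>t\<ge>0. onorm (T t) \<le> M)"

text \<open>With \<open>T t = e\<^bsup>t A\<^esup>\<close>, this is the semigroup \<open>e\<^bsup>t (A - s)\<^esup>\<close>.\<close>

definition rescale :: "real \<Rightarrow> (real \<Rightarrow> 'a::complex_banach \<Rightarrow> 'a) \<Rightarrow> real \<Rightarrow> 'a \<Rightarrow> 'a" where
  "rescale s T = (\<lambda>t x. exp (- (t * s)) *\<^sub>R T t x)"

definition real_semigroup ::
    "(real \<Rightarrow> 'a::banach_lattice complexification \<Rightarrow> 'a complexification) \<Rightarrow> bool" where
  "real_semigroup T \<longleftrightarrow> (\<forall>t\<ge>0. real_operator (T t))"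

definition uniformly_eventually_positive ::
    "(real \<Rightarrow> 'a::banach_lattice complexification \<Rightarrow> 'a complexification) \<Rightarrow> bool" where
  "uniformly_eventually_positive T \<longleftrightarrow>
     (\<exists>t\<^sub>0\<ge>0. \<forall>t\<ge>t\<^sub>0. \<forall>f. nonneg f \<longrightarrow> nonneg (T t f))"

definition persistently_irreducible ::
    "(real \<Rightarrow> 'a::banach_lattice complexification \<Rightarrow> 'a complexification) \<Rightarrow> bool" where
  "persistently_irreducible T \<longleftrightarrow>
     (\<forall>I. closed I \<and> lattice_ideal I \<and> (\<exists>t\<^sub>0\<ge>0. \<forall>t\<ge>t\<^sub>0. T t ` I \<subseteq> I) \<longrightarrow> I = {0} \<or> I = UNIV)"

end

theory Submission
  imports Defs "HOL-Real_Asymp.Real_Asymp"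
begin

text \<open>
  Rescale to \<open>s(A) = 0\<close>. Boundedness makes the pole \<open>0\<close> simple, its residue \<open>P\<close> is positive and
  fixed by the semigroup, and irreducibility gives \<open>P = \<phi>(\<cdot>) u\<close> with \<open>u \<ge> 0\<close>. For an approximate
  eigenvector \<open>w\<close> to \<open>\<i>\<beta>\<close> one has \<open>\<bar>w\<bar> \<le> S\<^sub>t \<bar>w\<bar> + o(1)\<close> for large \<open>t\<close>, hence
  \<open>\<bar>w\<bar> \<le> \<phi>(\<bar>w\<bar>) u + o(1)\<close> in norm, and applying \<open>\<phi>\<close> shows that \<open>\<bar>w\<bar>\<close> is \<open>\<phi>\<close>-almost the constant
  multiple \<open>\<phi>(\<bar>w\<bar>) u\<close>. This applies to all differences \<open>z - c w\<close>, \<open>\<bar>c\<bar> = 1\<close>, of normalized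
  approximate eigenvectors. Their pointwise infimum over \<open>c\<close> is \<open>\<bar>\<bar>z\<bar> - \<bar>w\<bar>\<bar> \<approx> 0\<close>, so, all of them
  being almost constant, one of them is small. Thus normalized approximate eigenvectors agree up to
  phase and small error, and a suitable sequence of them converges to an eigenvector.
\<close>

section \<open>Complex Banach spaces\<close>

text \<open>Positivity holds only from \<open>t\<^sub>0\<close> on, so the resolvent R(\<kappa>)
  need not be positive for any given \<kappa> > 0. Only the residue inherits it, because
  \<open>P (S t v) = P v\<close> lets an initial piece of the orbit be discarded. Order information
  is therefore carried from orbits to \<open>P\<close> by sublinear gauges, such as the norm of a
  negative part, using that \<kappa>R(\<kappa>) tends to \<open>P\<close>. Two asymmetries shape the
  end. Domination by the semigroup bounds |w| in norm only from above; the matching lower bound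
  holds merely after applying \<phi>. Smallness is thus obtained first for \<phi>(|.|) and then
  moved to the norm by the upper bound. Moreover \<phi> respects sums but not infima: the shortfalls
  of all competing phases have to be added up, which is affordable only for a finite net of phases,
  fixed by the accuracy alone before the approximate eigenvectors are chosen.\<close>

lemma scaleC_one [simp]: "1 *\<^sub>C x = x" for x :: "'a::complex_banach"
  using scaleR_eq_scaleC[of 1 x] by simp

lemma scaleC_zero_right [simp]: "c *\<^sub>C (0::'a::complex_banach) = 0"
  using norm_scaleC[of c "0::'a"] by simp

lemma scaleC_zero_left [simp]: "0 *\<^sub>C x = (0::'a::complex_banach)"
  using norm_scaleC[of 0 x] by simp

lemma scaleC_minus_right [simp]: "c *\<^sub>C (- x) = - (c *\<^sub>C x)" for x :: "'a::complex_banach"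
  using scaleC_add_right[of c x "- x"] by (simp add: add_eq_0_iff)

lemma scaleC_minus_left [simp]: "(- c) *\<^sub>C x = - (c *\<^sub>C x)" for x :: "'a::complex_banach"
  using scaleC_add_left[of c "- c" x] by (simp add: add_eq_0_iff)

lemma scaleC_diff_right: "c *\<^sub>C (x - y) = c *\<^sub>C x - c *\<^sub>C y" for x :: "'a::complex_banach"
  using scaleC_add_right[of c x "- y"] by simp

lemma scaleC_diff_left: "(c - d) *\<^sub>C x = c *\<^sub>C x - d *\<^sub>C x" for x :: "'a::complex_banach"
  using scaleC_add_left[of c "- d" x] by simp

lemma scaleR_scaleC: "c *\<^sub>C (r *\<^sub>R x) = r *\<^sub>R (c *\<^sub>C x)" for x :: "'a::complex_banach"
  by (simp add: scaleR_eq_scaleC scaleC_scaleC mult.commute)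

lemma bounded_bilinear_scaleC: "bounded_bilinear (scaleC :: complex \<Rightarrow> 'a \<Rightarrow> 'a::complex_banach)"
  by (rule bounded_bilinear.intro)
     (auto simp: scaleC_add_right scaleC_add_left scaleR_eq_scaleC scaleC_scaleC norm_scaleC
       scaleR_conv_of_real mult.commute intro!: exI[of _ 1])

lemmas tendsto_scaleC [tendsto_intros] = bounded_bilinear.tendsto[OF bounded_bilinear_scaleC]

lemma bounded_clinearD:
  assumes "bounded_clinear f"
  shows "f (x + y) = f x + f y" "f (x - y) = f x - f y" "f (- x) = - f x" "f 0 = 0"
    "f (r *\<^sub>R x) = r *\<^sub>R f x" "f (c *\<^sub>C x) = c *\<^sub>C f x" "norm (f x) \<le> onorm f * norm x"
    "bounded_linear f"
  using assms unfolding bounded_clinear_def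
  by (auto simp: linear_simps dest: onorm intro: bounded_linear.linear)

text \<open>The product rule for right derivatives at 0. Rescaling, exponential orbits and orbit
  estimates all pass through it; with \<open>- \<mu>\<close> it undoes a twist by
  \<open>\<mu>\<close>.\<close>

lemma difference_quotient_twist:
  fixes F :: "real \<Rightarrow> 'a::complex_banach"
  assumes "((\<lambda>h. (F h - x) /\<^sub>R h) \<longlongrightarrow> y) (at_right 0)"
  shows "((\<lambda>h. (exp (- (\<mu> * h)) *\<^sub>C F h - x) /\<^sub>R h) \<longlongrightarrow> y - \<mu> *\<^sub>C x) (at_right 0)"
proof -
  have "((\<lambda>z. exp (- (\<mu> * z))) has_field_derivative - \<mu>) (at 0)"
    by (auto intro!: derivative_eq_intros)
  then have "((\<lambda>z. (exp (- (\<mu> * z)) - 1) / z) \<longlongrightarrow> - \<mu>) (at 0)"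
    by (simp add: DERIV_def)
  moreover have "filterlim complex_of_real (at 0) (at_right 0)"
    by (auto simp: filterlim_at eventually_at_filter intro!: tendsto_eq_intros)
  ultimately have exp: "((\<lambda>h::real. (exp (- (\<mu> * h)) - 1) / h) \<longlongrightarrow> - \<mu>) (at_right 0)"
    by (rule filterlim_compose)
  have one: "((\<lambda>h::real. exp (- (\<mu> * h))) \<longlongrightarrow> 1) (at_right 0)"
    by (auto intro!: tendsto_eq_intros)
  have "((\<lambda>h. exp (- (\<mu> * h)) *\<^sub>C ((F h - x) /\<^sub>R h) + ((exp (- (\<mu> * h)) - 1) / h) *\<^sub>C x)
      \<longlongrightarrow> 1 *\<^sub>C y + (- \<mu>) *\<^sub>C x) (at_right 0)"
    by (intro tendsto_intros one exp assms)
  moreover have "exp (- (\<mu> * h)) *\<^sub>C ((F h - x) /\<^sub>R h) + ((exp (- (\<mu> * h)) - 1) / h) *\<^sub>C x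
      = (exp (- (\<mu> * h)) *\<^sub>C F h - x) /\<^sub>R h" for h
  proof -
    have "((exp (- (\<mu> * h)) - 1) / h) *\<^sub>C x = (exp (- (\<mu> * h)) *\<^sub>C x - x) /\<^sub>R h"
      by (simp add: scaleR_eq_scaleC scaleC_diff_right scaleC_scaleC divide_inverse
          left_diff_distrib right_diff_distrib scaleC_diff_left mult.commute)
    then show ?thesis
      by (simp add: scaleR_scaleC scaleC_diff_right flip: scaleR_right_distrib)
  qed
  ultimately show ?thesis by simp
qed

section \<open>Bounded semigroups and their generators\<close>

lemma eventually_at_right_0: "(\<And>h::real. 0 < h \<Longrightarrow> P h) \<Longrightarrow> eventually P (at_right 0)"
  by (auto simp: eventually_at_filter)

locale bounded_generator =
  fixes S :: "real \<Rightarrow> 'a::complex_banach \<Rightarrow> 'a"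
    and D :: "'a set"
    and B :: "'a \<Rightarrow> 'a"
    and M :: real
  assumes clinear: "0 \<le> t \<Longrightarrow> bounded_clinear (S t)"
    and S_0: "S 0 x = x"
    and S_add: "0 \<le> t \<Longrightarrow> 0 \<le> t' \<Longrightarrow> S (t + t') x = S t (S t' x)"
    and M_nonneg: "0 \<le> M"
    and S_bound: "0 \<le> t \<Longrightarrow> norm (S t x) \<le> M * norm x"
    and generator: "x \<in> D \<Longrightarrow> ((\<lambda>h. (S h x - x) /\<^sub>R h) \<longlongrightarrow> B x) (at_right 0)"
    and domainI: "((\<lambda>h. (S h x - x) /\<^sub>R h) \<longlongrightarrow> y) (at_right 0) \<Longrightarrow> x \<in> D"
begin

lemma generatorI:
  assumes "((\<lambda>h. (S h x - x) /\<^sub>R h) \<longlongrightarrow> y) (at_right 0)"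
  shows "x \<in> D" "B x = y"
proof -
  show "x \<in> D" using assms by (rule domainI)
  from generator[OF this] assms show "B x = y"
    by (rule tendsto_unique[rotated]) simp
qed

lemma generator_lin:
  assumes "x \<in> D" "y \<in> D"
  shows "c *\<^sub>C x + d *\<^sub>C y \<in> D" "B (c *\<^sub>C x + d *\<^sub>C y) = c *\<^sub>C B x + d *\<^sub>C B y"
proof -
  have "((\<lambda>h. c *\<^sub>C ((S h x - x) /\<^sub>R h) + d *\<^sub>C ((S h y - y) /\<^sub>R h)) \<longlongrightarrow> c *\<^sub>C B x + d *\<^sub>C B y) (at_right 0)"
    by (intro tendsto_intros generator assms)
  then have *: "((\<lambda>h. (S h (c *\<^sub>C x + d *\<^sub>C y) - (c *\<^sub>C x + d *\<^sub>C y)) /\<^sub>R h) \<longlongrightarrow> c *\<^sub>C B x + d *\<^sub>C B y) (at_right 0)"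
  proof (rule Lim_transform_eventually, intro eventually_at_right_0)
    fix h :: real assume "0 < h"
    then have S: "S h (c *\<^sub>C x + d *\<^sub>C y) = c *\<^sub>C S h x + d *\<^sub>C S h y"
      using clinear[of h] by (simp add: bounded_clinearD)
    show "c *\<^sub>C ((S h x - x) /\<^sub>R h) + d *\<^sub>C ((S h y - y) /\<^sub>R h)
        = (S h (c *\<^sub>C x + d *\<^sub>C y) - (c *\<^sub>C x + d *\<^sub>C y)) /\<^sub>R h"
      unfolding S by (simp add: scaleR_scaleC scaleC_diff_right scaleR_right_diff_distrib scaleR_right_distrib)
  qed
  then show "c *\<^sub>C x + d *\<^sub>C y \<in> D" "B (c *\<^sub>C x + d *\<^sub>C y) = c *\<^sub>C B x + d *\<^sub>C B y"
    by (rule generatorI)+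
qed

lemma generator_scaleC:
  assumes "x \<in> D"
  shows "c *\<^sub>C x \<in> D" "B (c *\<^sub>C x) = c *\<^sub>C B x"
  using generator_lin[OF assms assms, of c 0] by simp_all

lemma generator_diff:
  assumes "x \<in> D" "y \<in> D"
  shows "x - y \<in> D" "B (x - y) = B x - B y"
  using generator_lin[OF assms, of 1 "- 1"] by simp_all

lemma generator_commute:
  assumes "x \<in> D" "0 \<le> t"
  shows "S t x \<in> D" "B (S t x) = S t (B x)"
proof -
  have "((\<lambda>h. S t ((S h x - x) /\<^sub>R h)) \<longlongrightarrow> S t (B x)) (at_right 0)"
    by (rule bounded_linear.tendsto[OF _ generator[OF assms(1)]])
       (use clinear[OF assms(2)] in \<open>simp add: bounded_clinearD\<close>)
  then have *: "((\<lambda>h. (S h (S t x) - S t x) /\<^sub>R h) \<longlongrightarrow> S t (B x)) (at_right 0)"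
  proof (rule Lim_transform_eventually, intro eventually_at_right_0)
    fix h :: real assume "0 < h"
    then have "S h (S t x) = S t (S h x)"
      using S_add[of h t x] S_add[of t h x] assms(2) by (simp add: add.commute)
    then show "S t ((S h x - x) /\<^sub>R h) = (S h (S t x) - S t x) /\<^sub>R h"
      using clinear[OF assms(2)] by (simp add: bounded_clinearD)
  qed
  then show "S t x \<in> D" "B (S t x) = S t (B x)" by (rule generatorI)+
qed

text \<open>Stands in for closedness of \<open>B\<close>: the orbit identity survives norm limits
  because each \<open>S t\<close> is bounded, and it is differentiated only afterwards.\<close>

lemma eigenvectorI:
  fixes \<mu> :: complex
  assumes "\<And>t. 0 \<le> t \<Longrightarrow> S t x = exp (\<mu> * t) *\<^sub>C x"
  shows "x \<in> D" "B x = \<mu> *\<^sub>C x"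
proof -
  have "((\<lambda>h::real. (x - x) /\<^sub>R h) \<longlongrightarrow> 0) (at_right 0)" by simp
  from difference_quotient_twist[OF this, of "- \<mu>"]
  have "((\<lambda>h. (exp (\<mu> * h) *\<^sub>C x - x) /\<^sub>R h) \<longlongrightarrow> \<mu> *\<^sub>C x) (at_right 0)"
    by simp
  then have "((\<lambda>h. (S h x - x) /\<^sub>R h) \<longlongrightarrow> \<mu> *\<^sub>C x) (at_right 0)"
    by (rule Lim_transform_eventually) (auto intro!: eventually_at_right_0 simp: assms)
  then show "x \<in> D" "B x = \<mu> *\<^sub>C x" by (rule generatorI)+
qed

text \<open>Telescoping over steps of length \<open>t / n\<close> replaces the variation of constants formula.\<close>

lemma orbit_bound:
  assumes x: "x \<in> D" and t: "0 \<le> t" and \<mu>: "Re \<mu> = 0"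
  shows "norm (S t x - exp (\<mu> * t) *\<^sub>C x) \<le> M * t * norm (B x - \<mu> *\<^sub>C x)"
proof (cases "t = 0")
  case True
  then show ?thesis by (simp add: S_0)
next
  case False
  define E where "E h y = exp (- (\<mu> * complex_of_real h)) *\<^sub>C S h y" for h y
  \<comment> \<open>As \<open>Re \<mu> = 0\<close>, the twisted family \<open>E\<close> is a
    semigroup with the same bound \<open>M\<close>, so each increment costs at most \<open>M\<close>
    times the first one.\<close>
  have tele: "norm (E (real n * h) x - x) \<le> real n * (M * norm (E h x - x))" if h: "0 \<le> h" for n :: nat and h :: real
  proof (induction n)
    case 0
    then show ?case by (simp add: E_def S_0)
  next
    case (Suc n)
    have "E (Suc n * h) x - x = E (n * h) (E h x - x) + (E (n * h) x - x)"
    proof -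
      have "S (Suc n * h) x = S (n * h) (S h x)"
        using S_add[of "n * h" h x] h by (simp add: algebra_simps)
      moreover have "exp (- (\<mu> * complex_of_real (Suc n * h)))
          = exp (- (\<mu> * complex_of_real (n * h))) * exp (- (\<mu> * complex_of_real h))"
        by (simp add: algebra_simps flip: exp_add)
      ultimately have "E (Suc n * h) x = E (n * h) (E h x)"
        using clinear[of "n * h"] h by (simp add: E_def bounded_clinearD scaleC_scaleC)
      then show ?thesis
        using clinear[of "n * h"] h by (simp add: E_def bounded_clinearD scaleC_diff_right)
    qed
    also have "norm \<dots> \<le> norm (E (n * h) (E h x - x)) + norm (E (n * h) x - x)"
      by (rule norm_triangle_ineq)
    also have "norm (E (n * h) (E h x - x)) \<le> M * norm (E h x - x)"
      using S_bound[of "n * h"] h by (simp add: E_def norm_scaleC \<mu>)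
    finally show ?case using Suc.IH by (simp add: algebra_simps)
  qed
  have "norm (E t x - x) \<le> M * t * norm ((E (t / Suc n) x - x) /\<^sub>R (t / Suc n))" for n
  proof -
    have "norm (E (Suc n * (t / Suc n)) x - x) \<le> Suc n * (M * norm (E (t / Suc n) x - x))"
      using t by (intro tele) simp
    also have "\<dots> = M * t * norm ((E (t / Suc n) x - x) /\<^sub>R (t / Suc n))"
      using t False unfolding norm_scaleR by (simp add: field_simps del: of_nat_Suc)
    finally show ?thesis using t False by (simp del: of_nat_Suc)
  qed
  moreover have "(\<lambda>n. M * t * norm ((E (t / Suc n) x - x) /\<^sub>R (t / Suc n)))
      \<longlonglongrightarrow> M * t * norm (B x - \<mu> *\<^sub>C x)"
  proof (intro tendsto_intros)
    have "filterlim (\<lambda>n. t / Suc n) (at_right 0) sequentially"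
      using t False by real_asymp
    from filterlim_compose[OF difference_quotient_twist[OF generator[OF x], of \<mu>] this]
    show "(\<lambda>n. (E (t / Suc n) x - x) /\<^sub>R (t / Suc n)) \<longlonglongrightarrow> B x - \<mu> *\<^sub>C x"
      by (simp add: E_def)
  qed
  ultimately have "norm (E t x - x) \<le> M * t * norm (B x - \<mu> *\<^sub>C x)"
    by (intro LIMSEQ_le_const) auto
  moreover have "norm (S t x - exp (\<mu> * t) *\<^sub>C x) = norm (exp (\<mu> * t) *\<^sub>C (E t x - x))"
    by (simp add: E_def scaleC_diff_right scaleC_scaleC flip: exp_add)
  ultimately show ?thesis by (simp add: norm_scaleC \<mu>)
qed

text \<open>
  A substitute for \<open>R(\<kappa>) y = \<integral> e\<^bsup>-\<kappa>t\<^esup> S\<^sub>t y dt\<close>. With \<open>\<rho> = e\<^bsup>-\<kappa>h\<^esup>\<close>, \<open>c = h / (1 - \<rho>)\<close> and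
  \<open>v = (x - \<rho> S\<^sub>h x) / h\<close>, the vector \<open>S\<^sub>k\<^sub>h x / c - g\<close> is the convex combination of
  \<open>S\<^sub>k\<^sub>h v - g\<close> and \<open>S\<^sub>(\<^sub>k\<^sub>+\<^sub>1\<^sub>)\<^sub>h x / c - g\<close> with weights \<open>1 - \<rho>\<close> and \<open>\<rho>\<close>.
\<close>

lemma sublinear_resolvent_bound:
  fixes d :: "'a \<Rightarrow> real"
  assumes d_add: "\<And>x y. d (x + y) \<le> d x + d y"
    and d_scale: "\<And>c x. 0 \<le> c \<Longrightarrow> d (c *\<^sub>R x) \<le> c * d x"
    and d_norm: "\<And>x. d x \<le> norm x"
    and x: "x \<in> D" and \<kappa>: "0 < \<kappa>" and y: "\<kappa> *\<^sub>R x - B x = y"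
    and orbit: "\<And>t. 0 \<le> t \<Longrightarrow> d (S t y - g) \<le> a + b * t" and b: "0 \<le> b"
  shows "d (\<kappa> *\<^sub>R x - g) \<le> a + b / \<kappa>"
proof -
  define \<rho> where "\<rho> h = exp (- (\<kappa> * h))" for h
  define c where "c h = h / (1 - \<rho> h)" for h
  define v where "v h = (x - \<rho> h *\<^sub>R S h x) /\<^sub>R h" for h
  have lip: "d u \<le> d w + norm (u - w)" for u w
    using d_add[of w "u - w"] d_norm[of "u - w"] by simp
  have step: "d (x /\<^sub>R c h - g) \<le> a + M * norm (v h - y) + b * c h" if h: "0 < h" for h
  proof -
    have \<rho>: "0 < \<rho> h" "\<rho> h < 1" using h \<kappa> by (simp_all add: \<rho>_def)
    have c: "0 < c h" using h \<rho> by (simp add: c_def)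
    define a' where "a' = a + M * norm (v h - y)"
    \<comment> \<open>The subtracted affine function satisfies the recursion from above: by
      \<open>(1 - \<rho> h) * c h = h\<close> the term \<open>b * c h\<close> pays for the drift of
      one step. What remains is the homogeneous \<open>rec\<close>, and an upper bound on
      \<open>s\<close> then forces \<open>s 0 \<le> 0\<close>.\<close>
    define s where "s k = d (S (real k * h) x /\<^sub>R c h - g) - (a' + b * c h + b * (real k * h))" for k
    have rec: "s k \<le> \<rho> h * s (Suc k)" for k
    proof -
      let ?t = "real k * h"
      have t: "0 \<le> ?t" using h by simp
      note lin = bounded_clinearD[OF clinear[OF t]]
      have "S (real (Suc k) * h) x = S ?t (S h x)"
        using S_add[of ?t h x] h by (simp add: algebra_simps)
      then have Sv: "S ?t (v h) = (S ?t x - \<rho> h *\<^sub>R S (real (Suc k) * h) x) /\<^sub>R h"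
        by (simp add: v_def lin)
      have ic: "(1 - \<rho> h) *\<^sub>R inverse h *\<^sub>R u = inverse (c h) *\<^sub>R u" for u :: 'a
        by (simp add: c_def divide_inverse)
      have "(1 - \<rho> h) *\<^sub>R S ?t (v h)
          = S ?t x /\<^sub>R c h - \<rho> h *\<^sub>R (S (real (Suc k) * h) x /\<^sub>R c h)"
        unfolding Sv scaleR_right_diff_distrib ic by (simp add: mult.commute)
      then have "S ?t x /\<^sub>R c h - g
          = (1 - \<rho> h) *\<^sub>R (S ?t (v h) - g) + \<rho> h *\<^sub>R (S (real (Suc k) * h) x /\<^sub>R c h - g)"
        unfolding scaleR_right_diff_distrib by (simp add: scaleR_left_diff_distrib)
      then have "d (S ?t x /\<^sub>R c h - g) \<le> (1 - \<rho> h) * d (S ?t (v h) - g)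
          + \<rho> h * d (S (real (Suc k) * h) x /\<^sub>R c h - g)"
        using order.trans[OF d_add add_mono[OF d_scale d_scale]] \<rho> by simp
      moreover have "d (S ?t (v h) - g) \<le> a' + b * ?t"
      proof -
        have "d (S ?t (v h) - g) \<le> d (S ?t y - g) + norm (S ?t (v h - y))"
          using lip[of "S ?t (v h) - g" "S ?t y - g"] by (simp add: lin)
        then show ?thesis
          using orbit[OF t] S_bound[OF t, of "v h - y"] by (simp add: a'_def)
      qed
      then have "(1 - \<rho> h) * d (S ?t (v h) - g) \<le> (1 - \<rho> h) * (a' + b * ?t)"
        using \<rho> by (intro mult_left_mono) auto
      moreover have "b * h = (1 - \<rho> h) * (b * c h)" using \<rho> by (simp add: c_def)
      moreover have "\<rho> h * (b * h) \<le> b * h"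
        using \<rho> b h by (intro mult_left_le_one_le) auto
      ultimately show ?thesis unfolding s_def by (simp add: algebra_simps)
    qed
    define K where "K = M * norm (x /\<^sub>R c h) + norm g + \<bar>a' + b * c h\<bar>"
    have s_le: "s k \<le> K" for k
    proof -
      have t: "0 \<le> real k * h" using h by simp
      have "d (S (real k * h) x /\<^sub>R c h - g) \<le> norm (S (real k * h) (x /\<^sub>R c h)) + norm g"
        unfolding bounded_clinearD(5)[OF clinear[OF t]] by (rule order.trans[OF d_norm norm_triangle_ineq4])
      also have "norm (S (real k * h) (x /\<^sub>R c h)) \<le> M * norm (x /\<^sub>R c h)"
        by (rule S_bound[OF t])
      finally show ?thesis
        using mult_nonneg_nonneg[OF b t] by (simp add: s_def K_def)
    qed
    have "s 0 \<le> \<rho> h ^ k * s k" for k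
    proof (induction k)
      case (Suc k)
      also have "\<rho> h ^ k * s k \<le> \<rho> h ^ k * (\<rho> h * s (Suc k))"
        using rec \<rho> by (intro mult_left_mono) auto
      finally show ?case by (simp add: mult_ac)
    qed simp
    then have "s 0 \<le> \<rho> h ^ k * K" for k
      using order.trans mult_left_mono[OF s_le] \<rho> by (meson less_imp_le zero_le_power)
    moreover have "(\<lambda>k. \<rho> h ^ k * K) \<longlonglongrightarrow> 0 * K"
      using \<rho> by (intro tendsto_intros LIMSEQ_power_zero) simp
    ultimately have "s 0 \<le> 0" by (intro LIMSEQ_le_const) auto
    then show ?thesis by (simp add: s_def S_0 a'_def)
  qed
  have \<rho>_diff: "((\<lambda>h. (1 - \<rho> h) / h) \<longlongrightarrow> \<kappa>) (at_right 0)"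
  proof -
    have "((\<lambda>h. - exp (- (\<kappa> * h))) has_field_derivative \<kappa>) (at 0)"
      by (auto intro!: derivative_eq_intros)
    then have "((\<lambda>h. (1 - \<rho> h) / h) \<longlongrightarrow> \<kappa>) (at 0)" by (simp add: DERIV_def \<rho>_def)
    then show ?thesis by (simp add: filterlim_at_split)
  qed
  have c_inv: "((\<lambda>h. inverse (c h)) \<longlongrightarrow> \<kappa>) (at_right 0)"
    using \<rho>_diff by (simp add: c_def)
  have c_lim: "(c \<longlongrightarrow> inverse \<kappa>) (at_right 0)"
    using tendsto_inverse[OF c_inv] \<kappa> by simp
  have v_lim: "(v \<longlongrightarrow> y) (at_right 0)"
  proof -
    from difference_quotient_twist[OF generator[OF x], of \<kappa>]
    have "((\<lambda>h. - ((exp (- (complex_of_real \<kappa> * h)) *\<^sub>C S h x - x) /\<^sub>R h)) \<longlongrightarrow> - (B x - complex_of_real \<kappa> *\<^sub>C x)) (at_right 0)"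
      by (rule tendsto_minus)
    moreover have "- ((exp (- (complex_of_real \<kappa> * h)) *\<^sub>C S h x - x) /\<^sub>R h) = v h" for h
    proof -
      have "exp (- (complex_of_real \<kappa> * h)) = complex_of_real (\<rho> h)"
        by (simp add: \<rho>_def exp_of_real[symmetric])
      then show ?thesis by (simp add: v_def scaleR_eq_scaleC flip: scaleC_minus_right)
    qed
    ultimately show ?thesis using y by (simp add: scaleR_eq_scaleC)
  qed
  \<comment> \<open>In the limit \<open>c h\<close> becomes \<open>1 / \<kappa>\<close>; the
    resulting \<open>b / \<kappa>\<close> is the mean of \<open>b * t\<close> for the density
    \<kappa> e^(-\<kappa>t).\<close>
  have "d (\<kappa> *\<^sub>R x - g) \<le> norm (\<kappa> *\<^sub>R x - x /\<^sub>R c h) + (a + M * norm (v h - y) + b * c h)" if "0 < h" for h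
    using lip[of "\<kappa> *\<^sub>R x - g" "x /\<^sub>R c h - g"] step[OF that] by simp
  moreover have "((\<lambda>h. norm (\<kappa> *\<^sub>R x - x /\<^sub>R c h) + (a + M * norm (v h - y) + b * c h))
     \<longlongrightarrow> norm (\<kappa> *\<^sub>R x - \<kappa> *\<^sub>R x) + (a + M * norm (y - y) + b * inverse \<kappa>)) (at_right 0)"
    by (intro tendsto_intros c_inv c_lim v_lim)
  ultimately have "d (\<kappa> *\<^sub>R x - g)
      \<le> norm (\<kappa> *\<^sub>R x - \<kappa> *\<^sub>R x) + (a + M * norm (y - y) + b * inverse \<kappa>)"
    by (intro tendsto_lowerbound) (auto intro!: eventually_at_right_0)
  then show ?thesis by (simp add: divide_inverse)
qed

lemma resolvent_bound:
  assumes "x \<in> D" "0 < \<kappa>"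
  shows "norm (\<kappa> *\<^sub>R x) \<le> M * norm (\<kappa> *\<^sub>R x - B x)"
  using sublinear_resolvent_bound[of norm x \<kappa> _ 0 "M * norm (\<kappa> *\<^sub>R x - B x)" 0] assms
  by (simp add: norm_triangle_ineq S_bound)

end

section \<open>The resolvent near the spectrum\<close>

context bounded_generator
begin

lemma resolvent_properties:
  assumes "\<mu> \<in> resolvent_set D B"
  shows "resolvent D B \<mu> y \<in> D"
    and "\<mu> *\<^sub>C resolvent D B \<mu> y - B (resolvent D B \<mu> y) = y"
    and "x \<in> D \<Longrightarrow> resolvent D B \<mu> (\<mu> *\<^sub>C x - B x) = x"
    and "bounded_clinear (resolvent D B \<mu>)"
proof -
  have bij: "bij_betw (\<lambda>x. \<mu> *\<^sub>C x - B x) D UNIV"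
    using assms by (simp add: resolvent_set_def)
  then have y: "y \<in> (\<lambda>x. \<mu> *\<^sub>C x - B x) ` D" by (simp add: bij_betw_def)
  show "resolvent D B \<mu> y \<in> D"
    unfolding resolvent_def by (rule inv_into_into[OF y])
  show "\<mu> *\<^sub>C resolvent D B \<mu> y - B (resolvent D B \<mu> y) = y"
    unfolding resolvent_def using f_inv_into_f[OF y] by simp
  show "resolvent D B \<mu> (\<mu> *\<^sub>C x - B x) = x" if "x \<in> D"
    unfolding resolvent_def using inv_into_f_f[OF bij_betw_imp_inj_on[OF bij] that] by simp
  show "bounded_clinear (resolvent D B \<mu>)"
    using assms by (simp add: resolvent_set_def)
qed

lemma resolvent_setI:
  assumes lower: "\<And>x. x \<in> D \<Longrightarrow> \<delta> * norm x \<le> norm (\<mu> *\<^sub>C x - B x)" and \<delta>: "0 < \<delta>"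
    and surj: "\<And>y. \<exists>x\<in>D. \<mu> *\<^sub>C x - B x = y"
  shows "\<mu> \<in> resolvent_set D B"
proof -
  let ?F = "\<lambda>x. \<mu> *\<^sub>C x - B x"
  have inj: "x = x'" if "x \<in> D" "x' \<in> D" "?F x = ?F x'" for x x'
  proof -
    have "\<delta> * norm (x - x') \<le> norm (?F (x - x'))"
      by (intro lower generator_diff that)
    also have "?F (x - x') = ?F x - ?F x'"
      using that(1,2) by (simp add: generator_diff scaleC_diff_right)
    also have "norm (?F x - ?F x') = 0" unfolding that(3) by simp
    finally show ?thesis using \<delta> by (simp add: mult_le_0_iff)
  qed
  have bij: "bij_betw ?F D UNIV"
    unfolding bij_betw_def inj_on_def using inj surj by (auto simp: image_iff) metis
  have R: "resolvent D B \<mu> (?F x) = x" if "x \<in> D" for x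
    unfolding resolvent_def using inv_into_f_f[OF bij_betw_imp_inj_on[OF bij] that] by simp
  have lin: "resolvent D B \<mu> (c *\<^sub>C y + d *\<^sub>C z) = c *\<^sub>C resolvent D B \<mu> y + d *\<^sub>C resolvent D B \<mu> z"
    for c d y z
  proof -
    obtain v w where v: "v \<in> D" "?F v = y" and w: "w \<in> D" "?F w = z" using surj[of y] surj[of z] by blast
    have "c *\<^sub>C y + d *\<^sub>C z = ?F (c *\<^sub>C v + d *\<^sub>C w)"
      using v w by (auto simp: generator_lin scaleC_add_right scaleC_diff_right scaleC_scaleC mult.commute)
    then show ?thesis using R[OF generator_lin(1)[OF v(1) w(1)], of c d] R[OF v(1)] R[OF w(1)] v(2) w(2) by simp
  qed
  have "bounded_linear (resolvent D B \<mu>)"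
  proof (rule bounded_linear_intro[where K = "1 / \<delta>"])
    show "resolvent D B \<mu> (y + z) = resolvent D B \<mu> y + resolvent D B \<mu> z" for y z
      using lin[of 1 y 1 z] by simp
    show "resolvent D B \<mu> (r *\<^sub>R y) = r *\<^sub>R resolvent D B \<mu> y" for r y
      using lin[of r y 0 y] by (simp add: scaleR_eq_scaleC)
    show "norm (resolvent D B \<mu> y) \<le> norm y * (1 / \<delta>)" for y
    proof -
      obtain x where x: "x \<in> D" "?F x = y" using surj by blast
      then show ?thesis using lower[OF x(1)] R[OF x(1)] \<delta> by (simp add: field_simps)
    qed
  qed
  moreover have "resolvent D B \<mu> (c *\<^sub>C y) = c *\<^sub>C resolvent D B \<mu> y" for c y
    using lin[of c y 0 y] by simp
  ultimately show ?thesis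
    using bij by (simp add: resolvent_set_def bounded_clinear_def)
qed

text \<open>If \<open>\<mu> - B\<close> were bounded below, the resolvents just to the right of
  \<open>\<mu>\<close> would be uniformly bounded, and the equation at \<open>\<mu>\<close> could be
  solved by perturbation from there.\<close>

lemma approximate_eigenvector:
  assumes \<mu>: "\<mu> \<notin> resolvent_set D B"
    and near: "\<And>\<epsilon>. 0 < \<epsilon> \<Longrightarrow> \<mu> + complex_of_real \<epsilon> \<in> resolvent_set D B"
    and \<delta>: "0 < \<delta>"
  shows "\<exists>z\<in>D. norm z = 1 \<and> norm (B z - \<mu> *\<^sub>C z) \<le> \<delta>"
proof (rule ccontr)
  assume neg: "\<not> ?thesis"
  have lower: "\<delta> * norm x \<le> norm (\<mu> *\<^sub>C x - B x)" if x: "x \<in> D" for x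
  proof (cases "x = 0")
    case False
    define z where "z = complex_of_real (inverse (norm x)) *\<^sub>C x"
    have z: "z \<in> D" "B z - \<mu> *\<^sub>C z = complex_of_real (inverse (norm x)) *\<^sub>C (B x - \<mu> *\<^sub>C x)"
      using generator_scaleC[OF x] by (auto simp: z_def scaleC_diff_right scaleC_scaleC mult.commute)
    have "norm z = 1" using False by (simp add: z_def norm_scaleC norm_inverse)
    then have "\<delta> \<le> norm (B z - \<mu> *\<^sub>C z)" using neg z(1) by force
    also have "\<dots> = norm (\<mu> *\<^sub>C x - B x) / norm x"
      unfolding z(2) by (simp add: norm_scaleC norm_inverse norm_minus_commute divide_inverse mult.commute)
    finally show ?thesis using False by (simp add: field_simps)
  qed simp
  \<comment> \<open>With a third of \<open>\<delta>\<close>, the estimate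
    \<open>\<delta> * norm (R y) \<le> norm y + \<epsilon> * norm (R y)\<close> leaves the
    contraction factor 1/2. A fixed point of \<open>R (y + \<epsilon> *\<^sub>R u)\<close> in
    \<open>u\<close> solves the equation at \<open>\<mu>\<close>, since the shift by
    \<open>\<epsilon>\<close> cancels.\<close>
  define \<epsilon> where "\<epsilon> = \<delta> / 3"
  define R where "R = resolvent D B (\<mu> + \<epsilon>)"
  have \<epsilon>: "0 < \<epsilon>" using \<delta> by (simp add: \<epsilon>_def)
  note R = resolvent_properties[OF near[OF \<epsilon>], folded R_def]
  have R_eq: "\<mu> *\<^sub>C R y - B (R y) = y - \<epsilon> *\<^sub>R R y" for y
    using R(2)[of y] by (simp add: scaleC_add_left scaleR_eq_scaleC algebra_simps)
  have R_bound: "\<epsilon> * norm (R y) \<le> norm y / 2" for y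
  proof -
    have "\<delta> * norm (R y) \<le> norm (y - \<epsilon> *\<^sub>R R y)" using lower[OF R(1), of y] by (simp add: R_eq)
    also have "\<dots> \<le> norm y + \<epsilon> * norm (R y)" using norm_triangle_ineq4[of y "\<epsilon> *\<^sub>R R y"] \<epsilon> by simp
    finally show ?thesis by (simp add: \<epsilon>_def)
  qed
  have "\<exists>x\<in>D. \<mu> *\<^sub>C x - B x = y" for y
  proof -
    have "dist (R (y + \<epsilon> *\<^sub>R u)) (R (y + \<epsilon> *\<^sub>R v)) \<le> 1/2 * dist u v" for u v
    proof -
      have "R (y + \<epsilon> *\<^sub>R u) - R (y + \<epsilon> *\<^sub>R v) = \<epsilon> *\<^sub>R R (u - v)"
        by (simp add: bounded_clinearD[OF R(4)] scaleR_right_diff_distrib)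
      then show ?thesis using R_bound[of "u - v"] \<epsilon> by (simp add: dist_norm)
    qed
    then have "\<exists>!u. R (y + \<epsilon> *\<^sub>R u) = u"
      by (intro banach_fix_type[of "1/2"]) auto
    then obtain u where u: "R (y + \<epsilon> *\<^sub>R u) = u" by blast
    have "u \<in> D" using R(1)[of "y + \<epsilon> *\<^sub>R u"] u by simp
    moreover have "\<mu> *\<^sub>C u - B u = y" using R_eq[of "y + \<epsilon> *\<^sub>R u"] u by simp
    ultimately show ?thesis by blast
  qed
  with lower \<delta> have "\<mu> \<in> resolvent_set D B" by (intro resolvent_setI)
  with \<mu> show False ..
qed

text \<open>Boundedness of the semigroup forces the pole to be simple, so \<open>P\<close> is the residue.\<close>

lemma resolvent_simple_pole:
  assumes "resolvent_pole D B 0"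
  obtains P K r where "bounded_clinear P" "P \<noteq> (\<lambda>x. 0)" "0 \<le> K" "0 < r"
    and "\<forall>\<kappa> v. 0 < \<kappa> \<longrightarrow> \<kappa> < r \<longrightarrow> (\<exists>x\<in>D. \<kappa> *\<^sub>R x - B x = v)"
    and "\<forall>\<kappa>. 0 < \<kappa> \<longrightarrow> \<kappa> < r \<longrightarrow> (\<forall>x\<in>D.
      norm (\<kappa> *\<^sub>R x - P (\<kappa> *\<^sub>R x - B x)) \<le> K * \<kappa> * norm (\<kappa> *\<^sub>R x - B x))"
proof -
  obtain r m U where r: "0 < r" and m: "1 \<le> m" and U_clinear: "\<forall>n. bounded_clinear (U n)"
    and U_0: "U 0 \<noteq> (\<lambda>x. 0)"
    and expansion: "\<forall>\<mu>. 0 < cmod (\<mu> - 0) \<and> cmod (\<mu> - 0) < r \<longrightarrow> \<mu> \<in> resolvent_set D B \<and>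
       (\<lambda>N. onorm (\<lambda>x. resolvent D B \<mu> x - (\<Sum>n<N. ((\<mu> - 0) powi (int n - int m)) *\<^sub>C U n x))) \<longlonglongrightarrow> 0"
    using assms unfolding resolvent_pole_def by (elim exE conjE) (rule that; assumption)
  have U: "bounded_clinear (U n)" for n using U_clinear by simp
  have laurent: "\<mu> \<in> resolvent_set D B \<and>
       (\<lambda>N. onorm (\<lambda>x. resolvent D B \<mu> x - (\<Sum>n<N. (\<mu> powi (int n - int m)) *\<^sub>C U n x))) \<longlonglongrightarrow> 0"
    if "0 < cmod \<mu>" "cmod \<mu> < r" for \<mu>
    using expansion[rule_format, of \<mu>] that by simp
  define R where "R \<kappa> = resolvent D B (complex_of_real \<kappa>)" for \<kappa>
  define L where "L N \<kappa> x = (\<Sum>n<N. (\<kappa> ^ n / \<kappa> ^ m) *\<^sub>R U n x)" for N \<kappa> x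
  have rho: "complex_of_real \<kappa> \<in> resolvent_set D B" if "0 < \<kappa>" "\<kappa> < r" for \<kappa>
    using laurent[of \<kappa>] that by simp
  note R = resolvent_properties[OF rho, folded R_def]
  have onorm_lim: "(\<lambda>N. onorm (\<lambda>x. R \<kappa> x - L N \<kappa> x)) \<longlonglongrightarrow> 0" if "0 < \<kappa>" "\<kappa> < r" for \<kappa>
  proof -
    have "complex_of_real \<kappa> powi (int n - int m) = complex_of_real (\<kappa> ^ n / \<kappa> ^ m)" for n
      using that by (simp add: power_int_diff)
    then have "(complex_of_real \<kappa> powi (int n - int m)) *\<^sub>C y = (\<kappa> ^ n / \<kappa> ^ m) *\<^sub>R y" for n and y :: 'a
      unfolding scaleR_eq_scaleC by simp
    then show ?thesis using laurent[of \<kappa>] that by (simp add: R_def L_def)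
  qed
  have diff_bound: "norm (R \<kappa> x - L N \<kappa> x) \<le> onorm (\<lambda>x. R \<kappa> x - L N \<kappa> x) * norm x"
    if "0 < \<kappa>" "\<kappa> < r" for \<kappa> x N
    unfolding L_def
    by (rule onorm) (intro bounded_linear_sub bounded_linear_sum
        bounded_linear_compose[OF bounded_linear_scaleR_right] bounded_clinearD(8)[OF R(4)[OF that]]
        bounded_clinearD(8)[OF U])
  have L_lim: "(\<lambda>N. L N \<kappa> x) \<longlonglongrightarrow> R \<kappa> x" if "0 < \<kappa>" "\<kappa> < r" for \<kappa> x
  proof -
    have "(\<lambda>N. onorm (\<lambda>x. R \<kappa> x - L N \<kappa> x) * norm x) \<longlonglongrightarrow> 0"
      by (intro tendsto_mult_left_zero onorm_lim that)
    then have "(\<lambda>N. R \<kappa> x - L N \<kappa> x) \<longlonglongrightarrow> 0"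
      by (rule Lim_null_comparison[rotated]) (use diff_bound[OF that] in simp)
    then have "(\<lambda>N. R \<kappa> x - (R \<kappa> x - L N \<kappa> x)) \<longlonglongrightarrow> R \<kappa> x - 0"
      by (intro tendsto_intros)
    then show ?thesis by simp
  qed
  define q where "q = r / 2"
  have q: "0 < q" "q < r" using r by (simp_all add: q_def)
  \<comment> \<open>Each term of the expansion at \<open>q\<close> is a difference of consecutive
    remainders, so bounded remainders give Cauchy-type estimates for \<open>U n\<close>.\<close>
  obtain c where c: "0 < c" "\<And>N. norm (onorm (\<lambda>x. R q x - L N q x)) \<le> c"
    using convergent_imp_Bseq[OF convergentI[OF onorm_lim[OF q]]] by (auto elim: BseqE)
  define C where "C = 2 * c * q ^ m"
  have C: "0 \<le> C" using c q by (simp add: C_def)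
  have U_bound: "q ^ n * norm (U n x) \<le> C * norm x" for n x
  proof -
    have "norm (R q x - L N q x) \<le> c * norm x" for N
      using order.trans[OF diff_bound[OF q, of x N] mult_right_mono[of _ c "norm x"]] c(2)[of N] by simp
    moreover have "(q ^ n / q ^ m) *\<^sub>R U n x = (R q x - L n q x) - (R q x - L (Suc n) q x)"
      by (simp add: L_def)
    ultimately have "norm ((q ^ n / q ^ m) *\<^sub>R U n x) \<le> c * norm x + c * norm x"
      using order.trans[OF norm_triangle_ineq4 add_mono] by metis
    then show ?thesis using q by (simp add: C_def field_simps)
  qed
  \<comment> \<open>For \<open>\<kappa> < q / 2\<close> the terms from index 1 on are dominated by
    \<open>(\<kappa> / q) * C\<close> times powers of 1/2, whose sum is at most 2.\<close>
  define K where "K = 2 * C / q"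
  have K: "0 \<le> K" using C q by (simp add: K_def)
  have near: "norm (\<kappa> ^ m *\<^sub>R R \<kappa> x - U 0 x) \<le> K * \<kappa> * norm x" if \<kappa>: "0 < \<kappa>" "\<kappa> < q / 2" for \<kappa> x
  proof -
    have \<kappa>r: "0 < \<kappa>" "\<kappa> < r" using \<kappa> q by auto
    have "norm (\<kappa> ^ m *\<^sub>R L (Suc N) \<kappa> x - U 0 x) \<le> K * \<kappa> * norm x" for N
    proof -
      have "\<kappa> ^ m *\<^sub>R L (Suc N) \<kappa> x = (\<Sum>n<Suc N. \<kappa> ^ n *\<^sub>R U n x)"
        using \<kappa> unfolding L_def scaleR_sum_right by (intro sum.cong) auto
      then have "\<kappa> ^ m *\<^sub>R L (Suc N) \<kappa> x - U 0 x = (\<Sum>n<N. \<kappa> ^ Suc n *\<^sub>R U (Suc n) x)"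
        unfolding sum.lessThan_Suc_shift by simp
      also have "norm \<dots> \<le> (\<Sum>n<N. (\<kappa> / q) * (1/2) ^ n * (C * norm x))"
      proof (rule sum_norm_le)
        fix n
        have "norm (\<kappa> ^ Suc n *\<^sub>R U (Suc n) x) = (\<kappa> / q) ^ Suc n * (q ^ Suc n * norm (U (Suc n) x))"
          using \<kappa> q by (simp add: power_divide)
        also have "\<dots> \<le> (\<kappa> / q) ^ Suc n * (C * norm x)"
          using \<kappa> q by (intro mult_left_mono U_bound) auto
        also have "\<dots> \<le> (\<kappa> / q) * (1/2) ^ n * (C * norm x)"
          using \<kappa> q C unfolding power_Suc
          by (intro mult_right_mono mult_left_mono power_mono) (auto simp: field_simps)
        finally show "norm (\<kappa> ^ Suc n *\<^sub>R U (Suc n) x) \<le> (\<kappa> / q) * (1/2) ^ n * (C * norm x)" .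
      qed
      also have "\<dots> = (\<kappa> / q) * (C * norm x) * (\<Sum>n<N. (1/2) ^ n)"
        by (simp add: sum_distrib_left mult_ac)
      also have "\<dots> \<le> (\<kappa> / q) * (C * norm x) * 2"
        using \<kappa> q C by (intro mult_left_mono) (auto simp: sum_gp_strict)
      finally show ?thesis by (simp add: K_def mult_ac)
    qed
    moreover have "(\<lambda>N. norm (\<kappa> ^ m *\<^sub>R L (Suc N) \<kappa> x - U 0 x)) \<longlonglongrightarrow> norm (\<kappa> ^ m *\<^sub>R R \<kappa> x - U 0 x)"
      by (intro tendsto_intros LIMSEQ_Suc L_lim[OF \<kappa>r])
    ultimately show ?thesis by (intro LIMSEQ_le_const2) auto
  qed
  have R_bound: "norm (\<kappa> *\<^sub>R R \<kappa> x) \<le> M * norm x" if "0 < \<kappa>" "\<kappa> < r" for \<kappa> x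
    using resolvent_bound[OF R(1)[OF that] that(1), of x] R(2)[OF that, of x]
    by (simp add: scaleR_eq_scaleC)
  \<comment> \<open>By \<open>near\<close>, \<open>\<kappa> ^ m *\<^sub>R R \<kappa> x\<close> tends
    to \<open>U 0 x\<close>. For m \<ge> 2 the bound on
    \<open>\<kappa> *\<^sub>R R \<kappa> x\<close> leaves a further factor \<open>\<kappa>\<close>,
    so the limit would be 0.\<close>
  have "m = 1"
  proof (rule ccontr)
    assume "m \<noteq> 1"
    then obtain k where k: "m = Suc (Suc k)" using m by (cases m; cases "m - 1") auto
    have "U 0 x = 0" for x
    proof -
      have "norm (U 0 x) \<le> \<kappa> * ((M + K) * norm x)" if \<kappa>: "0 < \<kappa>" "\<kappa> < min (q / 2) 1" for \<kappa>
      proof -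
        have "norm (\<kappa> ^ m *\<^sub>R R \<kappa> x) = \<kappa> ^ k * (\<kappa> * norm (\<kappa> *\<^sub>R R \<kappa> x))"
          using \<kappa> by (simp add: k mult_ac)
        also have "\<dots> \<le> 1 * (\<kappa> * norm (\<kappa> *\<^sub>R R \<kappa> x))"
          using \<kappa> by (intro mult_right_mono power_le_one) auto
        also have "\<dots> \<le> \<kappa> * (M * norm x)"
          using \<kappa> q R_bound[of \<kappa> x] by simp
        finally have "norm (\<kappa> ^ m *\<^sub>R R \<kappa> x) \<le> \<kappa> * (M * norm x)" .
        moreover have "norm (\<kappa> ^ m *\<^sub>R R \<kappa> x - U 0 x) \<le> K * \<kappa> * norm x"
          using near \<kappa> by simp
        ultimately show ?thesis
          using norm_triangle_sub[of "U 0 x" "\<kappa> ^ m *\<^sub>R R \<kappa> x"]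
          by (simp add: norm_minus_commute algebra_simps)
      qed
      then have "eventually (\<lambda>\<kappa>. norm (U 0 x) \<le> \<kappa> * ((M + K) * norm x)) (at_right 0)"
        using q by (auto simp: eventually_at_right_field intro!: exI[of _ "min (q / 2) 1"])
      moreover have "((\<lambda>\<kappa>. \<kappa> * ((M + K) * norm x)) \<longlongrightarrow> 0 * ((M + K) * norm x)) (at_right 0)"
        by (intro tendsto_intros)
      ultimately have "norm (U 0 x) \<le> 0 * ((M + K) * norm x)"
        by (intro tendsto_lowerbound) auto
      then show ?thesis by simp
    qed
    then show False using U_0 by auto
  qed
  show thesis
  proof (rule that[OF U U_0 K])
    show "0 < q / 2" using q by simp
    show "\<forall>\<kappa> v. 0 < \<kappa> \<longrightarrow> \<kappa> < q / 2 \<longrightarrow> (\<exists>x\<in>D. \<kappa> *\<^sub>R x - B x = v)"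
    proof (intro allI impI)
      fix \<kappa> v assume "0 < \<kappa>" "\<kappa> < q / 2"
      then have "0 < \<kappa>" "\<kappa> < r" using q by auto
      from R(1,2)[OF this, of v] show "\<exists>x\<in>D. \<kappa> *\<^sub>R x - B x = v"
        by (auto simp: scaleR_eq_scaleC)
    qed
    show "\<forall>\<kappa>. 0 < \<kappa> \<longrightarrow> \<kappa> < q / 2 \<longrightarrow> (\<forall>x\<in>D.
      norm (\<kappa> *\<^sub>R x - U 0 (\<kappa> *\<^sub>R x - B x)) \<le> K * \<kappa> * norm (\<kappa> *\<^sub>R x - B x))"
    proof (intro allI impI ballI)
      fix \<kappa> x assume \<kappa>: "0 < \<kappa>" "\<kappa> < q / 2" and x: "x \<in> D"
      then have "0 < \<kappa>" "\<kappa> < r" using q by auto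
      from R(3)[OF this x] have "R \<kappa> (\<kappa> *\<^sub>R x - B x) = x" by (simp add: scaleR_eq_scaleC)
      then show "norm (\<kappa> *\<^sub>R x - U 0 (\<kappa> *\<^sub>R x - B x)) \<le> K * \<kappa> * norm (\<kappa> *\<^sub>R x - B x)"
        using near[OF \<kappa>, of "\<kappa> *\<^sub>R x - B x"] \<open>m = 1\<close> by simp
    qed
  qed
qed

end

section \<open>Banach lattices\<close>

lemma pprt_add_le: "pprt (x + y) \<le> pprt x + pprt y" for x y :: "'a::banach_lattice"
  unfolding pprt_def by (intro sup_least add_mono add_nonneg_nonneg) auto

lemma pprt_scaleR_le: "pprt (c *\<^sub>R x) \<le> c *\<^sub>R pprt x" if "0 \<le> c" for x :: "'a::banach_lattice"
  unfolding pprt_def using that by (intro sup_least scaleR_left_mono scaleR_nonneg_nonneg) auto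

lemma pprt_le_abs: "pprt x \<le> \<bar>x\<bar>" for x :: "'a::banach_lattice"
  unfolding pprt_def by (intro sup_least le_abs_lattice) simp

lemma le_pprt: "x \<le> pprt x" for x :: "'a::banach_lattice"
  by (simp add: pprt_def)

lemma pprt_minus: "x = pprt x - pprt (- x)" for x :: "'a::banach_lattice"
  using prts[of x] by (simp add: pprt_neg)

lemma abs_eq_pprt: "\<bar>x\<bar> = pprt x + pprt (- x)" for x :: "'a::banach_lattice"
  using abs_prts[of x] by (simp add: pprt_neg)

lemma norm_pprt_le: "norm (pprt x) \<le> norm x" for x :: "'a::banach_lattice"
  using norm_mono_nonneg[OF zero_le_pprt pprt_le_abs[of x]] by simp

lemma norm_pprt_mono: "x \<le> y \<Longrightarrow> norm (pprt x) \<le> norm (pprt y)" for x y :: "'a::banach_lattice"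
  by (intro norm_mono_nonneg) (simp_all add: pprt_mono)

lemma norm_pprt_add: "norm (pprt (x + y)) \<le> norm (pprt x) + norm (pprt y)" for x y :: "'a::banach_lattice"
  using order.trans[OF norm_mono_nonneg[OF zero_le_pprt pprt_add_le] norm_triangle_ineq] .

lemma norm_pprt_scaleR: "norm (pprt (c *\<^sub>R x)) \<le> c * norm (pprt x)" if "0 \<le> c" for x :: "'a::banach_lattice"
  using norm_mono_nonneg[OF zero_le_pprt pprt_scaleR_le[OF that, of x]] that by simp

lemma le_if_norm_pprt_zero: "norm (pprt (x - y)) \<le> 0 \<Longrightarrow> x \<le> y" for x y :: "'a::banach_lattice"
  using le_pprt[of "x - y"] by simp

section \<open>The modulus on the complexification\<close>

lemma modulus_scaleC: "modulus (c *\<^sub>C z) = cmod c *\<^sub>R modulus z"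
proof (cases "c = 0")
  case True
  then show ?thesis using modulus_scaleC_le[of c z] by (intro order.antisym) simp_all
next
  case False
  have "modulus z = modulus (inverse c *\<^sub>C (c *\<^sub>C z))" using False by (simp add: scaleC_scaleC)
  also have "\<dots> \<le> inverse (cmod c) *\<^sub>R modulus (c *\<^sub>C z)"
    using modulus_scaleC_le[of "inverse c"] by (simp add: norm_inverse)
  finally have "cmod c *\<^sub>R modulus z \<le> cmod c *\<^sub>R inverse (cmod c) *\<^sub>R modulus (c *\<^sub>C z)"
    by (intro scaleR_left_mono) auto
  then show ?thesis using modulus_scaleC_le[of c z] False by (intro order.antisym) simp_all
qed

lemma re_part_le_modulus: "re_part z \<le> modulus z"
  using order.trans[OF le_abs_lattice(1) abs_re_le_modulus] .

lemma modulus_leI: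
  assumes "\<And>c. cmod c = 1 \<Longrightarrow> re_part (c *\<^sub>C z) \<le> u"
  shows "modulus z \<le> u"
  by (rule modulus_least) (use assms[of "cis (- _)"] in simp)

lemma modulus_real: "modulus (Complexify a 0) = \<bar>a\<bar>"
  using modulus_le[of "Complexify a 0"] abs_re_le_modulus[of "Complexify a 0"] by simp

lemma norm_modulus: "norm (modulus z) = norm z"
  by (simp add: norm_complexification_def)

lemma norm_Complexify_real: "norm (Complexify a 0) = norm a"
  by (simp add: norm_complexification_def modulus_real)

lemma modulus_zero_iff: "modulus z = 0 \<longleftrightarrow> z = 0"
  using norm_modulus[of z] by (metis norm_eq_zero)

lemma modulus_minus: "modulus (- z) = modulus z"
  using modulus_scaleC[of "- 1" z] by simp

lemma modulus_triangle: "\<bar>modulus z - modulus w\<bar> \<le> modulus (z - w)"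
  using modulus_add[of "z - w" w] modulus_add[of "w - z" z] modulus_minus[of "z - w"]
  by (simp add: abs_lattice algebra_simps)

lemma continuous_on_modulus: "continuous_on S modulus"
proof -
  have "norm (modulus z - modulus w) \<le> norm (z - w)" for z w :: "'a complexification"
    using norm_mono_abs[of "modulus z - modulus w" "modulus (z - w)"] modulus_triangle[of z w]
    by (simp add: norm_modulus)
  then show ?thesis
    by (auto simp: continuous_on_iff dist_norm intro: order.strict_trans1)
qed

section \<open>Positive operators on the complexification\<close>

definition real_restriction ::
    "('a::banach_lattice complexification \<Rightarrow> 'a complexification) \<Rightarrow> 'a \<Rightarrow> 'a" where
  "real_restriction Q a = re_part (Q (Complexify a 0))"

locale positive_operator =
  fixes Q :: "'a::banach_lattice complexification \<Rightarrow> 'a complexification"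
  assumes clinear: "bounded_clinear Q"
    and positive: "nonneg f \<Longrightarrow> nonneg (Q f)"
begin

abbreviation "q \<equiv> real_restriction Q"

lemma restriction_linear:
  "q (a + b) = q a + q b" "q (a - b) = q a - q b" "q (r *\<^sub>R a) = r *\<^sub>R q a" "q 0 = 0"
proof -
  have "Complexify (a + b) 0 = Complexify a 0 + Complexify b (0::'a)"
    "Complexify (a - b) 0 = Complexify a 0 - Complexify b (0::'a)"
    "Complexify (r *\<^sub>R a) 0 = r *\<^sub>R Complexify a (0::'a)" "Complexify 0 (0::'a) = 0"
    by (auto intro: complexification_eqI)
  then show "q (a + b) = q a + q b" "q (a - b) = q a - q b" "q (r *\<^sub>R a) = r *\<^sub>R q a" "q 0 = 0"
    by (simp_all add: real_restriction_def bounded_clinearD[OF clinear])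
qed

lemma restriction_nonneg: "0 \<le> a \<Longrightarrow> 0 \<le> q a"
  using positive[of "Complexify a 0"] by (simp add: nonneg_def real_part_space_def real_restriction_def)

lemma restriction_mono: "a \<le> b \<Longrightarrow> q a \<le> q b"
  using restriction_nonneg[of "b - a"] by (simp add: restriction_linear)

lemma operator_real: "Q (Complexify a 0) = Complexify (q a) 0"
proof -
  have pos: "im_part (Q (Complexify b 0)) = 0" if "0 \<le> b" for b
    using positive[of "Complexify b 0"] that by (simp add: nonneg_def real_part_space_def)
  have "Complexify a 0 = Complexify (pprt a) 0 - Complexify (pprt (- a)) 0"
    using pprt_minus[of a] by (intro complexification_eqI) simp_all
  then have "im_part (Q (Complexify a 0)) = 0"
    by (simp add: bounded_clinearD[OF clinear] pos)
  then show ?thesis by (intro complexification_eqI) (simp_all add: real_restriction_def)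
qed

lemma re_part_operator: "re_part (Q z) = q (re_part z)"
proof -
  have "z = Complexify (re_part z) 0 + \<i> *\<^sub>C Complexify (im_part z) 0"
    by (intro complexification_eqI) simp_all
  then have "Q z = Q (Complexify (re_part z) 0) + \<i> *\<^sub>C Q (Complexify (im_part z) 0)"
    by (metis bounded_clinearD(1,6)[OF clinear])
  then show ?thesis by (simp add: operator_real)
qed

lemma modulus_operator: "modulus (Q z) \<le> q (modulus z)"
proof (rule modulus_leI)
  fix c :: complex assume "cmod c = 1"
  then have "re_part (c *\<^sub>C z) \<le> modulus z"
    using re_part_le_modulus[of "c *\<^sub>C z"] by (simp add: modulus_scaleC del: parts_simps)
  then have "q (re_part (c *\<^sub>C z)) \<le> q (modulus z)" by (rule restriction_mono)
  then show "re_part (c *\<^sub>C Q z) \<le> q (modulus z)"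
    by (metis re_part_operator bounded_clinearD(6)[OF clinear])
qed

lemma restriction_abs: "\<bar>q a\<bar> \<le> q \<bar>a\<bar>"
  using modulus_operator[of "Complexify a 0"] by (simp add: operator_real modulus_real)

lemma restriction_bound: "norm (q a) \<le> onorm Q * norm a"
  using bounded_clinearD(7)[OF clinear, of "Complexify a 0"]
  by (simp add: operator_real norm_Complexify_real)

end

section \<open>Aligning phases over a finite net\<close>

text \<open>A linear stand-in for Im^2 = |z|^2 - Re^2, which needs products: rotations by the unit
  vectors (p, q) and (p, -q) give the bound. For p near 1 the second coefficient is small, and the
  first multiplies only the gap between \<open>modulus z\<close> and
  \<open>re_part z\<close>.\<close>

lemma im_part_bound:
  assumes pq: "p\<^sup>2 + q\<^sup>2 = 1" and q: "0 < q"
  shows "\<bar>im_part z\<bar> \<le> (p / q) *\<^sub>R (modulus z - re_part z) + ((1 - p) / q) *\<^sub>R modulus z"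
proof -
  have unit: "cmod (Complex p r) = 1" if "r\<^sup>2 = q\<^sup>2" for r
    using pq that by (simp add: cmod_def)
  have "r *\<^sub>R im_part z \<le> modulus z - p *\<^sub>R re_part z" if "r\<^sup>2 = q\<^sup>2" for r
    using re_part_le_modulus[of "Complex p (- r) *\<^sub>C z"] unit[of "- r"] that
    by (simp add: modulus_scaleC algebra_simps)
  then have "(1 / q) *\<^sub>R r *\<^sub>R im_part z \<le> (1 / q) *\<^sub>R (modulus z - p *\<^sub>R re_part z)" if "r\<^sup>2 = q\<^sup>2" for r
    using q that by (intro scaleR_left_mono) auto
  from this[of q] this[of "- q"]
  have "\<bar>im_part z\<bar> \<le> (1 / q) *\<^sub>R (modulus z - p *\<^sub>R re_part z)"
    using q by (simp add: abs_lattice)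
  also have "\<dots> = (p / q) *\<^sub>R (modulus z - re_part z) + ((1 - p) / q) *\<^sub>R modulus z"
    by (simp add: scaleR_right_diff_distrib diff_divide_distrib scaleR_left_diff_distrib)
  finally show ?thesis .
qed

text \<open>The modulus is a supremum over all phases, each within \<open>\<eta>\<close> of
  \<open>N\<close>. Used twice in \<open>finite_alignment\<close>, to eliminate the phase of
  \<open>z\<close> and then that of \<open>w\<close>.\<close>

lemma modulus_net_bound:
  assumes net: "\<And>c. cmod c = 1 \<Longrightarrow> \<exists>d\<in>N. cmod (c - d) \<le> \<eta>"
    and L: "0 < L" and le: "\<And>d. d \<in> N \<Longrightarrow> L *\<^sub>R re_part (d *\<^sub>C z) \<le> u"
  shows "L *\<^sub>R modulus z \<le> u + (L * \<eta>) *\<^sub>R modulus z"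
proof -
  have "modulus z \<le> (1 / L) *\<^sub>R (u + (L * \<eta>) *\<^sub>R modulus z)"
  proof (rule modulus_leI)
    fix c :: complex assume "cmod c = 1"
    then obtain d where d: "d \<in> N" "cmod (c - d) \<le> \<eta>" using net by blast
    have "re_part (c *\<^sub>C z) = re_part (d *\<^sub>C z) + re_part ((c - d) *\<^sub>C z)"
      by (simp add: algebra_simps)
    also have "re_part ((c - d) *\<^sub>C z) \<le> \<eta> *\<^sub>R modulus z"
      using order.trans[OF re_part_le_modulus modulus_scaleC_le] scaleR_right_mono[OF d(2), of "modulus z"]
      by (meson modulus_nonneg order.trans)
    finally have "L *\<^sub>R re_part (c *\<^sub>C z) \<le> L *\<^sub>R (re_part (d *\<^sub>C z) + \<eta> *\<^sub>R modulus z)"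
      using L by (intro scaleR_left_mono) auto
    also have "\<dots> \<le> u + (L * \<eta>) *\<^sub>R modulus z"
      using le[OF d(1)] unfolding scaleR_right_distrib scaleR_scaleR by (intro add_right_mono)
    finally have "(1 / L) *\<^sub>R (L *\<^sub>R re_part (c *\<^sub>C z)) \<le> (1 / L) *\<^sub>R (u + (L * \<eta>) *\<^sub>R modulus z)"
      using L by (intro scaleR_left_mono) auto
    then show "re_part (c *\<^sub>C z) \<le> (1 / L) *\<^sub>R (u + (L * \<eta>) *\<^sub>R modulus z)"
      using L by (simp del: parts_simps)
  qed
  then have "L *\<^sub>R modulus z \<le> L *\<^sub>R ((1 / L) *\<^sub>R (u + (L * \<eta>) *\<^sub>R modulus z))"
    using L by (intro scaleR_left_mono) auto
  then show ?thesis using L by simp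
qed

lemma finite_unit_circle_net:
  assumes "0 < \<eta>"
  obtains N where "finite N" "\<And>c. c \<in> N \<Longrightarrow> cmod c = 1"
    "\<And>c. cmod c = 1 \<Longrightarrow> \<exists>d\<in>N. cmod (c - d) \<le> \<eta>"
proof -
  have "\<exists>N. finite N \<and> N \<subseteq> sphere 0 1 \<and> sphere (0::complex) 1 \<subseteq> (\<Union>c\<in>N. ball c \<eta>)"
    by (rule seq_compact_imp_totally_bounded[rule_format])
       (auto simp: compact_imp_seq_compact assms)
  then obtain N where N: "finite N" "N \<subseteq> sphere 0 1" "sphere (0::complex) 1 \<subseteq> (\<Union>c\<in>N. ball c \<eta>)"
    by blast
  have "\<exists>d\<in>N. cmod (c - d) \<le> \<eta>" if "cmod c = 1" for c
  proof -
    have "c \<in> sphere 0 1" using that by simp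
    with N(3) have "c \<in> (\<Union>c\<in>N. ball c \<eta>)" by (rule subsetD)
    then show ?thesis by (auto simp: dist_norm norm_minus_commute intro: less_imp_le)
  qed
  with N show thesis by (intro that[of N]) auto
qed

text \<open>
  At each point of a function lattice, some \<open>c\<close> in a fine net of the unit circle almost turns
  \<open>w\<close> into the direction of \<open>z\<close>. Here \<open>re_part (c z)\<close> close to \<open>\<bar>z\<bar>\<close> replaces the choice of the
  point, and distributivity of infima over sums replaces the case distinction.
\<close>

lemma finite_alignment:
  assumes t: "0 < t"
  obtains N where "finite N" "N \<noteq> {}" "\<And>c. c \<in> N \<Longrightarrow> cmod c = 1"
    "\<And>(z :: 'a::banach_lattice complexification) w h.
      (\<And>c. c \<in> N \<Longrightarrow> h \<le> modulus (z - c *\<^sub>C w)) \<Longrightarrow>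
      h \<le> \<bar>modulus z - modulus w\<bar> + t *\<^sub>R (modulus z + modulus w)"
proof -
  \<comment> \<open>\<open>s\<close> is the tangent of half the angle of \<open>(p, q)\<close>, so
    \<open>(1 - p) / q = s\<close> exactly; \<open>s \<le> 1\<close> keeps \<open>p\<close>
    nonnegative. Half of \<open>t\<close> is spent on \<open>s\<close>, the other half on the net
    through \<open>L * \<eta>\<close>.\<close>
  define s where "s = min 1 (t / 2)"
  have s: "0 < s" "s \<le> 1" "s \<le> t / 2" using t by (auto simp: s_def)
  define p q where "p = (1 - s\<^sup>2) / (1 + s\<^sup>2)" and "q = 2 * s / (1 + s\<^sup>2)"
  have s2: "0 < 1 + s\<^sup>2" by (simp add: add_pos_nonneg)
  have q: "0 < q" using s s2 by (simp add: q_def)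
  have "p\<^sup>2 + q\<^sup>2 = ((1 - s\<^sup>2)\<^sup>2 + (2 * s)\<^sup>2) / (1 + s\<^sup>2)\<^sup>2"
    by (simp add: p_def q_def power_divide add_divide_distrib)
  also have "(1 - s\<^sup>2)\<^sup>2 + (2 * s)\<^sup>2 = (1 + s\<^sup>2)\<^sup>2" by algebra
  finally have pq: "p\<^sup>2 + q\<^sup>2 = 1" using s2 by simp
  have "1 - p = 2 * s\<^sup>2 / (1 + s\<^sup>2)" using s2 by (simp add: p_def field_simps)
  then have ps: "(1 - p) / q = s" using s s2 by (simp add: q_def power2_eq_square)
  \<comment> \<open>A deviation \<open>X - re_part v\<close> enters once through the real parts and
    \<open>p / q\<close> times through the imaginary parts.\<close>
  define L where "L = p / q + 1"
  have "0 \<le> p" using s s2 by (simp add: p_def power_le_one)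
  then have L: "0 < L" using q by (simp add: L_def add_nonneg_pos)
  define \<eta> where "\<eta> = t / (2 * L)"
  have \<eta>: "0 < \<eta>" "L * \<eta> = t / 2" using t L by (simp_all add: \<eta>_def)
  obtain N where N: "finite N" "\<And>c. c \<in> N \<Longrightarrow> cmod c = 1"
    "\<And>c. cmod c = 1 \<Longrightarrow> \<exists>d\<in>N. cmod (c - d) \<le> \<eta>"
    using finite_unit_circle_net[OF \<eta>(1)] by blast
  \<comment> \<open>Quotients of net points allow separate rotations:
    \<open>modulus (z - (cnj c * d) *\<^sub>C w)\<close> equals
    \<open>modulus (c *\<^sub>C z - d *\<^sub>C w)\<close>.\<close>
  show thesis
  proof (rule that[of "(\<lambda>(c, d). cnj c * d) ` (N \<times> N)"])
    show "finite ((\<lambda>(c, d). cnj c * d) ` (N \<times> N))" using N(1) by simp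
    have "N \<noteq> {}" using N(3)[of 1] by auto
    then show "(\<lambda>(c, d). cnj c * d) ` (N \<times> N) \<noteq> {}" by auto
    show "cmod c = 1" if "c \<in> (\<lambda>(c, d). cnj c * d) ` (N \<times> N)" for c
      using that N(2) by (auto simp: norm_mult)
    fix z w :: "'a complexification" and h
    assume h: "\<And>c. c \<in> (\<lambda>(c, d). cnj c * d) ` (N \<times> N) \<Longrightarrow> h \<le> modulus (z - c *\<^sub>C w)"
    define X Y where "X = modulus z" and "Y = modulus w"
    define G where "G = \<bar>X - Y\<bar> + s *\<^sub>R (X + Y)"
    have pair: "h \<le> G + L *\<^sub>R (X - re_part (c *\<^sub>C z)) + L *\<^sub>R (Y - re_part (d *\<^sub>C w))"
      if cd: "c \<in> N" "d \<in> N" for c d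
    proof -
      define v v' where "v = c *\<^sub>C z" and "v' = d *\<^sub>C w"
      have mod: "modulus v = X" "modulus v' = Y"
        using N(2) cd by (simp_all add: v_def v'_def X_def Y_def modulus_scaleC)
      have cc: "c * cnj c = 1" using complex_norm_square[of c] N(2)[OF cd(1)] by simp
      have "h \<le> modulus (z - (cnj c * d) *\<^sub>C w)" using h cd by blast
      also have "\<dots> = modulus (c *\<^sub>C (z - (cnj c * d) *\<^sub>C w))"
        using N(2) cd by (simp add: modulus_scaleC)
      also have "c *\<^sub>C (z - (cnj c * d) *\<^sub>C w) = v - v'"
        by (simp add: v_def v'_def scaleC_diff_right scaleC_scaleC cc flip: mult.assoc)
      also have "modulus (v - v') \<le> \<bar>re_part v - re_part v'\<bar> + \<bar>im_part v - im_part v'\<bar>"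
        using modulus_le[of "v - v'"] by simp
      also have "\<bar>re_part v - re_part v'\<bar> \<le> \<bar>X - Y\<bar> + (X - re_part v) + (Y - re_part v')"
      proof -
        have "re_part v - re_part v' = (X - Y) - (X - re_part v) + (Y - re_part v')" by simp
        also have "\<bar>\<dots>\<bar> \<le> \<bar>X - Y\<bar> + \<bar>X - re_part v\<bar> + \<bar>Y - re_part v'\<bar>"
          by (meson abs_triangle_ineq abs_triangle_ineq4 add_mono order.refl order.trans)
        finally show ?thesis
          using re_part_le_modulus[of v] re_part_le_modulus[of v'] by (simp add: mod)
      qed
      also have "\<bar>im_part v - im_part v'\<bar> \<le> \<bar>im_part v\<bar> + \<bar>im_part v'\<bar>"
        by (rule abs_triangle_ineq4)
      also have "\<bar>im_part v\<bar> \<le> (p / q) *\<^sub>R (X - re_part v) + s *\<^sub>R X"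
        using im_part_bound[OF pq q, of v] by (simp add: mod ps)
      also have "\<bar>im_part v'\<bar> \<le> (p / q) *\<^sub>R (Y - re_part v') + s *\<^sub>R Y"
        using im_part_bound[OF pq q, of v'] by (simp add: mod ps)
      finally have "h \<le> \<bar>X - Y\<bar> + (X - re_part v) + (Y - re_part v') +
          ((p / q) *\<^sub>R (X - re_part v) + s *\<^sub>R X + ((p / q) *\<^sub>R (Y - re_part v') + s *\<^sub>R Y))"
        by simp
      also have "\<dots> = G + L *\<^sub>R (X - re_part v) + L *\<^sub>R (Y - re_part v')"
        by (simp add: G_def L_def scaleR_left_distrib scaleR_right_distrib add_ac)
      finally show ?thesis by (simp add: v_def v'_def del: parts_simps)
    qed
    \<comment> \<open>For fixed \<open>d\<close>, the supremum over \<open>c\<close> in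
      \<open>pair\<close> removes the deviation of \<open>z\<close> at the cost of
      \<open>(t / 2) *\<^sub>R X\<close>; the same argument in \<open>d\<close> then removes that of
      \<open>w\<close>.\<close>
    have "L *\<^sub>R re_part (d *\<^sub>C w) \<le> G + L *\<^sub>R Y - h + (t / 2) *\<^sub>R X" if d: "d \<in> N" for d
    proof -
      have "L *\<^sub>R re_part (c *\<^sub>C z) \<le> G + L *\<^sub>R X + L *\<^sub>R (Y - re_part (d *\<^sub>C w)) - h" if "c \<in> N" for c
        using pair[OF that d] by (simp add: scaleR_right_diff_distrib algebra_simps del: parts_simps)
      from modulus_net_bound[OF N(3) L this]
      have "L *\<^sub>R X \<le> G + L *\<^sub>R X + L *\<^sub>R (Y - re_part (d *\<^sub>C w)) - h + (t / 2) *\<^sub>R X"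
        by (simp add: X_def \<eta>(2) del: parts_simps)
      then show ?thesis by (simp add: scaleR_right_diff_distrib algebra_simps del: parts_simps)
    qed
    from modulus_net_bound[OF N(3) L this]
    have "L *\<^sub>R Y \<le> G + L *\<^sub>R Y - h + (t / 2) *\<^sub>R X + (t / 2) *\<^sub>R Y"
      by (simp add: Y_def \<eta>(2))
    then have "h \<le> \<bar>X - Y\<bar> + (s + t / 2) *\<^sub>R (X + Y)"
      by (simp add: G_def algebra_simps)
    also have "\<dots> \<le> \<bar>X - Y\<bar> + t *\<^sub>R (X + Y)"
      using s by (intro add_left_mono scaleR_right_mono) (auto simp: X_def Y_def)
    finally show "h \<le> \<bar>modulus z - modulus w\<bar> + t *\<^sub>R (modulus z + modulus w)"
      by (simp add: X_def Y_def)
  qed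
qed

section \<open>Irreducible eventually positive semigroups\<close>

lemma nonpos_if_le_small_multiples:
  fixes a C r :: real
  assumes "0 < r" "\<And>\<kappa>. 0 < \<kappa> \<Longrightarrow> \<kappa> < r \<Longrightarrow> a \<le> \<kappa> * C"
  shows "a \<le> 0"
proof -
  have "eventually (\<lambda>\<kappa>. a \<le> \<kappa> * C) (at_right 0)"
    using assms by (auto simp: eventually_at_right_field)
  moreover have "((\<lambda>\<kappa>. \<kappa> * C) \<longlongrightarrow> 0 * C) (at_right 0)" by (intro tendsto_intros)
  ultimately have "a \<le> 0 * C" by (intro tendsto_lowerbound) auto
  then show ?thesis by simp
qed

text \<open>The common Lipschitz constant lets the witness \<open>n\<close> of a nearby point serve
  for \<open>x\<close>. Both ideals fed to \<open>real_ideal_trivial\<close> have this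
  shape.\<close>

lemma closed_equi_Lipschitz_inf:
  fixes G :: "nat \<Rightarrow> 'a::real_normed_vector \<Rightarrow> real"
  assumes lip: "\<And>n a b. G n a \<le> G n b + C * norm (a - b)"
  shows "closed {x. \<forall>\<epsilon>>0. \<exists>n. G n x \<le> \<epsilon>}" (is "closed ?S")
proof -
  have "x \<in> ?S" if x: "x \<in> closure ?S" for x
  proof (intro CollectI allI impI)
    fix \<epsilon> :: real assume \<epsilon>: "0 < \<epsilon>"
    define e where "e = \<epsilon> / (2 * (\<bar>C\<bar> + 1))"
    have "0 < e" using \<epsilon> by (simp add: e_def add_nonneg_pos)
    then obtain y where y: "y \<in> ?S" "dist y x < e" using x unfolding closure_approachable by blast
    obtain n where n: "G n y \<le> \<epsilon> / 2" using y(1) \<epsilon> by (auto dest: spec[of _ "\<epsilon> / 2"])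
    have "C * norm (x - y) \<le> (\<bar>C\<bar> + 1) * e"
      using y(2) \<open>0 < e\<close> by (intro mult_mono) (auto simp: dist_norm norm_minus_commute)
    also have "\<dots> = \<epsilon> / 2" by (simp add: e_def add_nonneg_pos field_simps)
    finally have "G n x \<le> \<epsilon>" using lip[of n x y] n by simp
    then show "\<exists>n. G n x \<le> \<epsilon>" ..
  qed
  then have "closure ?S \<subseteq> ?S" by (rule subsetI)
  then show ?thesis by (simp only: closure_subset_eq)
qed

lemma inf_pprt_pprt_minus: "inf (pprt x) (pprt (- x)) = 0" for x :: "'a::banach_lattice"
proof -
  have "inf (pprt x) (pprt (- x)) = pprt (- x) + inf (pprt x - pprt (- x)) 0"
    by (simp add: add_inf_distrib_left)
  also have "\<dots> = 0"
    using pprt_minus[of x] by (simp add: pprt_neg nprt_def[symmetric])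
  finally show ?thesis .
qed

text \<open>For \<open>w = inf v (n u)\<close> with n > 0, the vector \<open>w / n\<close> lies
  below \<open>u\<close> and \<open>v\<close> and hence vanishes: no multiple of \<open>u\<close>
  absorbs any part of \<open>v\<close>.\<close>

lemma pprt_diff_disjoint:
  fixes u v :: "'a::banach_lattice"
  assumes "0 \<le> u" "0 \<le> v" "inf u v = 0"
  shows "pprt (v - real n *\<^sub>R u) = v"
proof (cases "n = 0")
  case False
  define w where "w = inf v (real n *\<^sub>R u)"
  have w: "0 \<le> w" "w \<le> v" "w \<le> real n *\<^sub>R u"
    using assms by (simp_all add: w_def scaleR_nonneg_nonneg)
  have "(1 / real n) *\<^sub>R w \<le> (1 / real n) *\<^sub>R (real n *\<^sub>R u)"
    using w by (intro scaleR_left_mono) auto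
  moreover have "(1 / real n) *\<^sub>R w \<le> 1 *\<^sub>R w"
    using w False by (intro scaleR_right_mono) auto
  ultimately have "(1 / real n) *\<^sub>R w \<le> inf u v"
    using False w by (auto intro: order.trans)
  then have "real n *\<^sub>R ((1 / real n) *\<^sub>R w) \<le> real n *\<^sub>R 0"
    using assms by (intro scaleR_left_mono) auto
  then have "w \<le> 0" using False by simp
  then have "w = 0" using w(1) by (rule order.antisym)
  moreover have "pprt (v - real n *\<^sub>R u) = v - w"
    by (simp add: pprt_def w_def diff_inf_eq_sup add_sup_distrib_left sup_commute)
  ultimately show ?thesis by simp
qed (use assms in simp)

text \<open>Two gauges in the format of \<open>sublinear_resolvent_bound\<close>; a vector is
  \<open>nonneg\<close> exactly when both vanish on it.\<close>

lemma sublinear_parts: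
  fixes x y :: "'a::banach_lattice complexification"
  shows "norm (pprt (- re_part (x + y))) \<le> norm (pprt (- re_part x)) + norm (pprt (- re_part y))"
    and "0 \<le> c \<Longrightarrow> norm (pprt (- re_part (c *\<^sub>R x))) \<le> c * norm (pprt (- re_part x))"
    and "norm (pprt (- re_part x)) \<le> norm x"
    and "norm (im_part (x + y)) \<le> norm (im_part x) + norm (im_part y)"
    and "0 \<le> c \<Longrightarrow> norm (im_part (c *\<^sub>R x)) \<le> c * norm (im_part x)"
    and "norm (im_part x) \<le> norm x"
  using norm_pprt_add[of "- re_part x" "- re_part y"] norm_pprt_scaleR[of c "- re_part x"]
    order.trans[OF norm_pprt_le[of "- re_part x"]] norm_parts_le(1,2)[of x]
  by (simp_all add: norm_triangle_ineq)

text \<open>The resolvent appears through its graph: with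
  \<open>y = \<kappa> *\<^sub>R x - B x\<close>, the assumption \<open>residue\<close> says that
  \<kappa>R(\<kappa>)y differs from \<open>P y\<close> by at most
  \<open>K * \<kappa> * norm y\<close>.\<close>

locale irreducible_generator = bounded_generator S D B M
  for S :: "real \<Rightarrow> 'a::banach_lattice complexification \<Rightarrow> 'a complexification" and D B M +
  fixes t\<^sub>0 :: real
    and P :: "'a complexification \<Rightarrow> 'a complexification"
    and K r :: real
  assumes t\<^sub>0: "0 \<le> t\<^sub>0"
    and eventually_positive: "t\<^sub>0 \<le> t \<Longrightarrow> nonneg f \<Longrightarrow> nonneg (S t f)"
    and irreducible: "closed I \<Longrightarrow> lattice_ideal I \<Longrightarrow> (\<And>t. t\<^sub>0 \<le> t \<Longrightarrow> S t ` I \<subseteq> I) \<Longrightarrow> I = {0} \<or> I = UNIV"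
    and P_clinear: "bounded_clinear P"
    and P_nonzero: "P \<noteq> (\<lambda>x. 0)"
    and K: "0 \<le> K"
    and r: "0 < r"
    and surj: "0 < \<kappa> \<Longrightarrow> \<kappa> < r \<Longrightarrow> \<exists>x\<in>D. \<kappa> *\<^sub>R x - B x = v"
    and residue: "0 < \<kappa> \<Longrightarrow> \<kappa> < r \<Longrightarrow> x \<in> D \<Longrightarrow>
      norm (\<kappa> *\<^sub>R x - P (\<kappa> *\<^sub>R x - B x)) \<le> K * \<kappa> * norm (\<kappa> *\<^sub>R x - B x)"
begin

section \<open>The residue as a positive projection\<close>

text \<open>\<open>P v\<close> is the limit of \<open>\<kappa> *\<^sub>R x\<close> with x =
  R(\<kappa>)v. Since \<open>B x = \<kappa> *\<^sub>R x - v\<close> stays bounded,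
  \<open>S t\<close> moves \<open>x\<close> by a bounded amount and
  \<open>\<kappa> *\<^sub>R x\<close> by O(\<kappa>).\<close>

lemma S_P:
  assumes t: "0 \<le> t"
  shows "S t (P v) = P v"
proof -
  have "norm (S t (P v) - P v) \<le> \<kappa> * (M * K * norm v + M * t * (M * norm v + norm v) + K * norm v)"
    if \<kappa>: "0 < \<kappa>" "\<kappa> < r" for \<kappa>
  proof -
    obtain x where x: "x \<in> D" "\<kappa> *\<^sub>R x - B x = v" using surj[OF \<kappa>] by blast
    have near: "norm (\<kappa> *\<^sub>R x - P v) \<le> K * \<kappa> * norm v"
      using residue[OF \<kappa> x(1)] x(2) by simp
    have "norm (S t (P v - \<kappa> *\<^sub>R x)) \<le> M * norm (P v - \<kappa> *\<^sub>R x)" by (rule S_bound[OF t])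
    also have "\<dots> \<le> M * (K * \<kappa> * norm v)"
      using near M_nonneg by (intro mult_left_mono) (simp_all add: norm_minus_commute)
    finally have 1: "norm (S t (P v - \<kappa> *\<^sub>R x)) \<le> M * (K * \<kappa> * norm v)" .
    have "B x = \<kappa> *\<^sub>R x - v" using x(2) by (simp add: algebra_simps)
    then have "norm (B x) \<le> norm (\<kappa> *\<^sub>R x) + norm v" using norm_triangle_ineq4 by metis
    also have "\<dots> \<le> M * norm v + norm v" using resolvent_bound[OF x(1) \<kappa>(1)] x(2) by simp
    finally have "M * t * norm (B x) \<le> M * t * (M * norm v + norm v)"
      using M_nonneg t by (intro mult_left_mono) auto
    with orbit_bound[OF x(1) t, of 0]
    have "norm (S t x - x) \<le> M * t * (M * norm v + norm v)" by simp
    then have "\<kappa> * norm (S t x - x) \<le> \<kappa> * (M * t * (M * norm v + norm v))"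
      using \<kappa> by (intro mult_left_mono) auto
    moreover have "S t (\<kappa> *\<^sub>R x) - \<kappa> *\<^sub>R x = \<kappa> *\<^sub>R (S t x - x)"
      by (simp add: bounded_clinearD[OF clinear[OF t]] scaleR_right_diff_distrib)
    ultimately have 2: "norm (S t (\<kappa> *\<^sub>R x) - \<kappa> *\<^sub>R x) \<le> \<kappa> * (M * t * (M * norm v + norm v))"
      using \<kappa> by simp
    have "S t (P v) - P v = S t (P v - \<kappa> *\<^sub>R x) + (S t (\<kappa> *\<^sub>R x) - \<kappa> *\<^sub>R x) + (\<kappa> *\<^sub>R x - P v)"
      by (simp add: bounded_clinearD[OF clinear[OF t]])
    then have "norm (S t (P v) - P v) \<le> norm (S t (P v - \<kappa> *\<^sub>R x)) + norm (S t (\<kappa> *\<^sub>R x) - \<kappa> *\<^sub>R x)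
        + norm (\<kappa> *\<^sub>R x - P v)"
      by (simp only: norm_triangle_mono order.refl)
    with 1 2 near show ?thesis by (simp add: algebra_simps)
  qed
  from nonpos_if_le_small_multiples[OF r this] show ?thesis by simp
qed

text \<open>The resolvent commutes with \<open>S t\<close>, so
  \<open>\<kappa> *\<^sub>R S t x\<close> is close to \<open>P (S t v)\<close>, and also to
  \<open>S t (P v) = P v\<close>.\<close>

lemma P_S:
  assumes t: "0 \<le> t"
  shows "P (S t v) = P v"
proof -
  have "norm (P (S t v) - P v) \<le> \<kappa> * (K * M * norm v + M * K * norm v)"
    if \<kappa>: "0 < \<kappa>" "\<kappa> < r" for \<kappa>
  proof -
    obtain x where x: "x \<in> D" "\<kappa> *\<^sub>R x - B x = v" using surj[OF \<kappa>] by blast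
    note lin = bounded_clinearD[OF clinear[OF t]]
    have "\<kappa> *\<^sub>R S t x - B (S t x) = S t v"
      using generator_commute(2)[OF x(1) t] by (simp add: lin flip: x(2))
    with residue[OF \<kappa> generator_commute(1)[OF x(1) t]]
    have "norm (\<kappa> *\<^sub>R S t x - P (S t v)) \<le> K * \<kappa> * norm (S t v)" by simp
    also have "\<dots> \<le> K * \<kappa> * (M * norm v)"
      using K \<kappa> S_bound[OF t] by (intro mult_left_mono) auto
    finally have 1: "norm (\<kappa> *\<^sub>R S t x - P (S t v)) \<le> K * \<kappa> * (M * norm v)" .
    have "\<kappa> *\<^sub>R S t x - P v = S t (\<kappa> *\<^sub>R x - P v)"
      by (simp add: lin S_P[OF t])
    also have "norm \<dots> \<le> M * norm (\<kappa> *\<^sub>R x - P v)" by (rule S_bound[OF t])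
    also have "\<dots> \<le> M * (K * \<kappa> * norm v)"
      using residue[OF \<kappa> x(1)] x(2) M_nonneg by (intro mult_left_mono) auto
    finally have 2: "norm (\<kappa> *\<^sub>R S t x - P v) \<le> M * (K * \<kappa> * norm v)" .
    have "P (S t v) - P v = (\<kappa> *\<^sub>R S t x - P v) - (\<kappa> *\<^sub>R S t x - P (S t v))" by simp
    then have "norm (P (S t v) - P v) \<le> norm (\<kappa> *\<^sub>R S t x - P v) + norm (\<kappa> *\<^sub>R S t x - P (S t v))"
      using norm_triangle_ineq4 by metis
    with 1 2 show ?thesis by (simp add: algebra_simps)
  qed
  from nonpos_if_le_small_multiples[OF r this] show ?thesis by simp
qed

lemma P_P: "P (P v) = P v"
proof -
  have Pv: "P v \<in> D" "B (P v) = 0"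
    using eigenvectorI[of "P v" 0] by (simp_all add: S_P)
  have "norm (P v - P (P v)) \<le> \<kappa> * (K * norm (P v))" if \<kappa>: "0 < \<kappa>" "\<kappa> < r" for \<kappa>
  proof -
    have "norm (\<kappa> *\<^sub>R P v - P (\<kappa> *\<^sub>R P v)) \<le> K * \<kappa> * norm (\<kappa> *\<^sub>R P v)"
      using residue[OF \<kappa> Pv(1)] Pv(2) by simp
    then have "\<kappa> * norm (P v - P (P v)) \<le> \<kappa> * (\<kappa> * (K * norm (P v)))"
      using \<kappa> by (simp add: bounded_clinearD[OF P_clinear] mult_ac flip: scaleR_right_diff_distrib)
    then show ?thesis using \<kappa> by simp
  qed
  from nonpos_if_le_small_multiples[OF r this] show ?thesis by simp
qed

text \<open>Averaging the orbit costs \<open>b / \<kappa>\<close>, replacing \<kappa>R(\<kappa>) by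
  \<open>P\<close> a multiple of \<open>\<kappa>\<close>. With \<open>\<kappa>\<close> left free, it
  can tend to 0 when \<open>b = 0\<close> and be balanced otherwise.\<close>

lemma residue_sublinear_bound:
  fixes d :: "'a complexification \<Rightarrow> real"
  assumes d: "\<And>x y. d (x + y) \<le> d x + d y" "\<And>c x. 0 \<le> c \<Longrightarrow> d (c *\<^sub>R x) \<le> c * d x" "\<And>x. d x \<le> norm x"
    and orbit: "\<And>t. 0 \<le> t \<Longrightarrow> d (S t y - g) \<le> a + b * t" and b: "0 \<le> b"
    and \<kappa>: "0 < \<kappa>" "\<kappa> < r"
  shows "d (P y - g) \<le> a + b / \<kappa> + \<kappa> * (K * norm y)"
proof -
  obtain x where x: "x \<in> D" "\<kappa> *\<^sub>R x - B x = y" using surj[OF \<kappa>] by blast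
  have "d (P y - g) \<le> d (\<kappa> *\<^sub>R x - g) + d (P y - \<kappa> *\<^sub>R x)"
    using d(1)[of "\<kappa> *\<^sub>R x - g" "P y - \<kappa> *\<^sub>R x"] by simp
  also have "d (\<kappa> *\<^sub>R x - g) \<le> a + b / \<kappa>"
    using d x \<kappa>(1) orbit b by (intro sublinear_resolvent_bound)
  also have "d (P y - \<kappa> *\<^sub>R x) \<le> \<kappa> * (K * norm y)"
    using order.trans[OF d(3)[of "P y - \<kappa> *\<^sub>R x"]] residue[OF \<kappa> x(1)] x(2)
    by (simp add: norm_minus_commute mult_ac)
  finally show ?thesis by simp
qed

lemma P_positive:
  assumes "nonneg f"
  shows "nonneg (P f)"
proof -
  \<comment> \<open>Starting at time \<open>t\<^sub>0\<close> makes the whole orbit positive; by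
    \<open>P_S\<close> the delay is invisible to \<open>P\<close>.\<close>
  define y where "y = S t\<^sub>0 f"
  have y: "nonneg (S t y)" if "0 \<le> t" for t
    unfolding y_def S_add[OF that t\<^sub>0, symmetric]
    using that by (intro eventually_positive assms) simp
  have Py: "P y = P f" unfolding y_def by (rule P_S[OF t\<^sub>0])
  have "norm (pprt (- re_part (P y - 0))) \<le> \<kappa> * (K * norm y)" if \<kappa>: "0 < \<kappa>" "\<kappa> < r" for \<kappa>
    using residue_sublinear_bound[of "\<lambda>z. norm (pprt (- re_part z))" y 0 0 0, OF sublinear_parts(1-3) _ _ \<kappa>] y
    by (simp add: nonneg_def)
  from nonpos_if_le_small_multiples[OF r this] have "0 \<le> re_part (P f)"
    using le_if_norm_pprt_zero[of 0 "re_part (P f)"] by (simp add: Py)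
  moreover have "norm (im_part (P y - 0)) \<le> \<kappa> * (K * norm y)" if \<kappa>: "0 < \<kappa>" "\<kappa> < r" for \<kappa>
    using residue_sublinear_bound[of "\<lambda>z. norm (im_part z)" y 0 0 0, OF sublinear_parts(4-6) _ _ \<kappa>] y
    by (simp add: nonneg_def real_part_space_def)
  from nonpos_if_le_small_multiples[OF r this] have "im_part (P f) = 0"
    by (simp add: Py)
  ultimately show ?thesis by (simp add: nonneg_def real_part_space_def)
qed

sublocale P: positive_operator P
  by unfold_locales (rule P_clinear P_positive; assumption)+

lemma S_positive_operator: "t\<^sub>0 \<le> t \<Longrightarrow> positive_operator (S t)"
  using t\<^sub>0 by unfold_locales (auto intro: clinear eventually_positive)

abbreviation "p \<equiv> real_restriction P"

lemma restriction_S_p: "t\<^sub>0 \<le> t \<Longrightarrow> real_restriction (S t) (p a) = p a"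
  using S_P[of t "Complexify a 0"] t\<^sub>0
  unfolding P.operator_real by (simp add: real_restriction_def[of "S t"])

lemma p_restriction_S: "t\<^sub>0 \<le> t \<Longrightarrow> p (real_restriction (S t) a) = p a"
  using P_S[of t "Complexify a 0"] t\<^sub>0
  by (simp add: positive_operator.operator_real[OF S_positive_operator] P.operator_real)

lemma p_p: "p (p a) = p a"
  using P_P[of "Complexify a 0"] by (simp add: P.operator_real)

lemma restriction_S_bound: "t\<^sub>0 \<le> t \<Longrightarrow> norm (real_restriction (S t) a) \<le> M * norm a"
  using S_bound[of t "Complexify a 0"] t\<^sub>0
  by (simp add: positive_operator.operator_real[OF S_positive_operator] norm_Complexify_real)

section \<open>One-dimensionality of the real fixed space\<close>

text \<open>Irreducibility is transferred through the set of all \<open>z\<close> with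
  \<open>modulus z\<close> in \<open>J\<close>. Its scalar multiples come from natural multiples in
  \<open>J\<close> and solidity.\<close>

lemma real_ideal_trivial:
  assumes closed: "closed J" and zero: "0 \<in> J" and add: "\<And>x y. x \<in> J \<Longrightarrow> y \<in> J \<Longrightarrow> x + y \<in> J"
    and solid: "\<And>x y. x \<in> J \<Longrightarrow> \<bar>y\<bar> \<le> \<bar>x\<bar> \<Longrightarrow> y \<in> J"
    and inv: "\<And>t x. t\<^sub>0 \<le> t \<Longrightarrow> x \<in> J \<Longrightarrow> real_restriction (S t) x \<in> J"
  shows "J = {0} \<or> J = UNIV"
proof -
  define I where "I = {z. modulus z \<in> J}"
  have scale: "real n *\<^sub>R x \<in> J" if "x \<in> J" for n x
    by (induction n) (auto simp: zero scaleR_left_distrib intro: add that)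
  have solid': "y \<in> J" if "x \<in> J" "0 \<le> y" "y \<le> x" for x y
    using solid[OF that(1), of y] that order.trans[OF that(2,3)] by simp
  have "closed I"
    using continuous_on_closed_vimage[OF closed_UNIV, of modulus] closed continuous_on_modulus
    by (auto simp: I_def vimage_def)
  moreover have "lattice_ideal I"
  proof -
    have "modulus (c *\<^sub>C x) \<in> J" if "modulus x \<in> J" for c x
    proof -
      obtain n :: nat where "cmod c \<le> real n" using real_arch_simple by blast
      then have "modulus (c *\<^sub>C x) \<le> real n *\<^sub>R modulus x"
        unfolding modulus_scaleC by (intro scaleR_right_mono) auto
      then show ?thesis using solid' scale that modulus_nonneg by blast
    qed
    moreover have "modulus (x + y) \<in> J" if "modulus x \<in> J" "modulus y \<in> J" for x y
      using solid'[OF add[OF that]] modulus_add modulus_nonneg by blast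
    moreover have "modulus (0 :: 'a complexification) = 0" by (simp add: modulus_zero_iff)
    ultimately show ?thesis
      using zero solid' modulus_nonneg unfolding lattice_ideal_def csubspace_def I_def by auto
  qed
  moreover have "S t ` I \<subseteq> I" if t: "t\<^sub>0 \<le> t" for t
    using solid'[OF inv[OF t]] positive_operator.modulus_operator[OF S_positive_operator[OF t]] modulus_nonneg
    by (auto simp: I_def)
  ultimately have "I = {0} \<or> I = UNIV" by (rule irreducible)
  moreover have "x \<in> J \<longleftrightarrow> Complexify x 0 \<in> I" for x
    using solid[of x "\<bar>x\<bar>"] solid[of "\<bar>x\<bar>" x] by (auto simp: I_def modulus_real)
  moreover have "Complexify x 0 = 0 \<longleftrightarrow> x = 0" for x :: 'a
    by (simp add: zero_complexification_def)
  ultimately show ?thesis by auto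
qed

text \<open>The null ideal of \<open>p\<close> is invariant because \<open>P\<close> absorbs
  \<open>S t\<close>, and it is proper because \<open>P\<close> is nonzero.\<close>

lemma p_strictly_positive:
  assumes "p \<bar>a\<bar> = 0"
  shows "a = 0"
proof -
  \<comment> \<open>The quantifier over \<open>n\<close> is a dummy that gives the null ideal the
    shape of \<open>closed_equi_Lipschitz_inf\<close>.\<close>
  define J where "J = {a. \<forall>\<epsilon>>0. \<exists>n::nat. norm (p \<bar>a\<bar>) \<le> \<epsilon>}"
  have J: "J = {a. p \<bar>a\<bar> = 0}"
  proof -
    have "p \<bar>a\<bar> = 0" if "\<forall>\<epsilon>>0. norm (p \<bar>a\<bar>) \<le> \<epsilon>" for a
      using that field_le_epsilon[of "norm (p \<bar>a\<bar>)" 0] by simp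
    then show ?thesis by (auto simp: J_def)
  qed
  have abs_diff: "\<bar>a\<bar> - \<bar>b\<bar> \<le> \<bar>a - b\<bar>" for a b :: 'a
    using abs_triangle_ineq[of "a - b" b] by (simp add: diff_le_eq)
  have "closed J" unfolding J_def
  proof (rule closed_equi_Lipschitz_inf)
    fix a b :: 'a
    have "p \<bar>a\<bar> \<le> p \<bar>b\<bar> + p \<bar>a - b\<bar>"
      using P.restriction_mono[OF abs_diff[of a b]] by (simp add: P.restriction_linear algebra_simps)
    then have "norm (p \<bar>a\<bar>) \<le> norm (p \<bar>b\<bar> + p \<bar>a - b\<bar>)"
      by (intro norm_mono_nonneg P.restriction_nonneg) auto
    also have "\<dots> \<le> norm (p \<bar>b\<bar>) + norm (p \<bar>a - b\<bar>)" by (rule norm_triangle_ineq)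
    also have "norm (p \<bar>a - b\<bar>) \<le> onorm P * norm (a - b)"
      using P.restriction_bound[of "\<bar>a - b\<bar>"] by simp
    finally show "norm (p \<bar>a\<bar>) \<le> norm (p \<bar>b\<bar>) + onorm P * norm (a - b)" by simp
  qed
  moreover have "0 \<in> J" by (simp add: J P.restriction_linear)
  moreover have solid: "y \<in> J" if x: "p x = 0" and y: "\<bar>y\<bar> \<le> x" for x y
  proof -
    have "p \<bar>y\<bar> \<le> 0" using P.restriction_mono[OF y] x by simp
    then have "p \<bar>y\<bar> = 0" using P.restriction_nonneg[of "\<bar>y\<bar>"] by (intro order.antisym) simp_all
    then show ?thesis by (simp add: J)
  qed
  moreover have "x + y \<in> J" if "x \<in> J" "y \<in> J" for x y
    using solid[of "\<bar>x\<bar> + \<bar>y\<bar>" "x + y"] that by (simp add: J P.restriction_linear abs_triangle_ineq)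
  moreover have "y \<in> J" if "x \<in> J" "\<bar>y\<bar> \<le> \<bar>x\<bar>" for x y
    using solid[of "\<bar>x\<bar>" y] that by (simp add: J)
  moreover have "real_restriction (S t) x \<in> J" if t: "t\<^sub>0 \<le> t" and "x \<in> J" for t x
    using solid[OF _ positive_operator.restriction_abs[OF S_positive_operator[OF t]], of x] that
    by (simp add: J p_restriction_S)
  ultimately have "J = {0} \<or> J = UNIV" by (intro real_ideal_trivial)
  moreover have "J \<noteq> UNIV"
  proof
    assume "J = UNIV"
    then have "p \<bar>b\<bar> = 0" for b using J by auto
    then have "p b = 0" for b using P.restriction_abs[of b] by simp
    then have "modulus (P z) = 0" for z
      using P.modulus_operator[of z] by (intro order.antisym) simp_all
    then show False using P_nonzero by (auto simp: modulus_zero_iff)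
  qed
  ultimately show ?thesis using assms J by blast
qed

text \<open>\<open>\<bar>f\<bar> = \<bar>p f\<bar> \<le> p \<bar>f\<bar>\<close>, and the projection
  \<open>p\<close> annihilates the nonnegative difference.\<close>

lemma fixed_abs:
  assumes "p f = f"
  shows "p \<bar>f\<bar> = \<bar>f\<bar>"
proof -
  have "0 \<le> p \<bar>f\<bar> - \<bar>f\<bar>" using P.restriction_abs[of f] assms by simp
  then have "p \<bar>p \<bar>f\<bar> - \<bar>f\<bar>\<bar> = 0" by (simp add: P.restriction_linear p_p)
  from p_strictly_positive[OF this] show ?thesis by simp
qed

lemma fixed_pprt:
  assumes "p f = f"
  shows "p (pprt f) = pprt f"
proof -
  have "f + \<bar>f\<bar> = (pprt f - pprt (- f)) + (pprt f + pprt (- f))"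
    by (rule arg_cong2[where f = "(+)", OF pprt_minus abs_eq_pprt])
  then have "2 *\<^sub>R pprt f = f + \<bar>f\<bar>" by (simp add: scaleR_2)
  then have "2 *\<^sub>R p (pprt f) = 2 *\<^sub>R pprt f"
    using assms fixed_abs[OF assms] by (simp add: P.restriction_linear(1) flip: P.restriction_linear(3))
  then show ?thesis by simp
qed

text \<open>
  The set \<open>J\<close> in the proof is the closed ideal generated by \<open>u\<close>, written without a closure.
\<close>

lemma fixed_quasi_interior:
  assumes u: "p u = u" "0 \<le> u" "u \<noteq> 0" and \<epsilon>: "0 < \<epsilon>"
  shows "\<exists>n::nat. norm (pprt (\<bar>x\<bar> - real n *\<^sub>R u)) \<le> \<epsilon>"
proof -
  define J where "J = {x. \<forall>\<epsilon>>0. \<exists>n::nat. norm (pprt (\<bar>x\<bar> - real n *\<^sub>R u)) \<le> \<epsilon>}"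
  have "closed J" unfolding J_def
  proof (rule closed_equi_Lipschitz_inf[where C = 1])
    fix n :: nat and a b :: 'a
    have "\<bar>a\<bar> \<le> \<bar>b\<bar> + \<bar>a - b\<bar>" using abs_triangle_ineq[of b "a - b"] by simp
    then have "norm (pprt (\<bar>a\<bar> - real n *\<^sub>R u)) \<le> norm (pprt ((\<bar>b\<bar> - real n *\<^sub>R u) + \<bar>a - b\<bar>))"
      by (intro norm_pprt_mono) (simp add: algebra_simps)
    also have "\<dots> \<le> norm (pprt (\<bar>b\<bar> - real n *\<^sub>R u)) + norm (pprt \<bar>a - b\<bar>)" by (rule norm_pprt_add)
    finally show "norm (pprt (\<bar>a\<bar> - real n *\<^sub>R u)) \<le> norm (pprt (\<bar>b\<bar> - real n *\<^sub>R u)) + 1 * norm (a - b)"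
      by simp
  qed
  moreover have "0 \<in> J" by (auto simp: J_def intro!: exI[of _ 0])
  moreover have "x + y \<in> J" if x: "x \<in> J" and y: "y \<in> J" for x y
    unfolding J_def
  proof (intro CollectI allI impI)
    fix \<epsilon> :: real assume "0 < \<epsilon>"
    then have "0 < \<epsilon> / 2" by simp
    then obtain n m where nm: "norm (pprt (\<bar>x\<bar> - real n *\<^sub>R u)) \<le> \<epsilon> / 2"
        "norm (pprt (\<bar>y\<bar> - real m *\<^sub>R u)) \<le> \<epsilon> / 2"
      using x y unfolding J_def by blast
    have "norm (pprt (\<bar>x + y\<bar> - real (n + m) *\<^sub>R u)) \<le> norm (pprt ((\<bar>x\<bar> - real n *\<^sub>R u) + (\<bar>y\<bar> - real m *\<^sub>R u)))"
      using abs_triangle_ineq[of x y] by (intro norm_pprt_mono) (simp add: algebra_simps)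
    also have "\<dots> \<le> \<epsilon>" using norm_pprt_add[of "\<bar>x\<bar> - real n *\<^sub>R u" "\<bar>y\<bar> - real m *\<^sub>R u"] nm by simp
    finally show "\<exists>n. norm (pprt (\<bar>x + y\<bar> - real n *\<^sub>R u)) \<le> \<epsilon>" by blast
  qed
  moreover have "y \<in> J" if x: "x \<in> J" and y: "\<bar>y\<bar> \<le> \<bar>x\<bar>" for x y
  proof -
    have "norm (pprt (\<bar>y\<bar> - real n *\<^sub>R u)) \<le> norm (pprt (\<bar>x\<bar> - real n *\<^sub>R u))" for n
      using y by (intro norm_pprt_mono) simp
    then show ?thesis using x order.trans unfolding J_def by blast
  qed
  moreover have "real_restriction (S t) x \<in> J" if t: "t\<^sub>0 \<le> t" and x: "x \<in> J" for t x
    unfolding J_def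
  proof (intro CollectI allI impI)
    fix \<epsilon> :: real assume \<epsilon>: "0 < \<epsilon>"
    interpret St: positive_operator "S t" by (rule S_positive_operator[OF t])
    have "0 < \<epsilon> / (M + 1)" using \<epsilon> M_nonneg by simp
    then obtain n where n: "norm (pprt (\<bar>x\<bar> - real n *\<^sub>R u)) \<le> \<epsilon> / (M + 1)"
      using x unfolding J_def by blast
    \<comment> \<open>As \<open>S t\<close> fixes \<open>u\<close>, the excess over
      \<open>n u\<close> after applying \<open>S t\<close> is dominated by the image of the excess
      before; \<open>M + 1\<close> avoids a zero denominator.\<close>
    have "\<bar>St.q x\<bar> - real n *\<^sub>R u \<le> St.q \<bar>x\<bar> - real n *\<^sub>R u"
      using St.restriction_abs by simp
    also have "\<dots> = St.q (\<bar>x\<bar> - real n *\<^sub>R u)"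
      using restriction_S_p[OF t, of u] u(1) by (simp add: St.restriction_linear)
    also have "\<dots> \<le> St.q (pprt (\<bar>x\<bar> - real n *\<^sub>R u))" by (intro St.restriction_mono le_pprt)
    finally have "norm (pprt (\<bar>St.q x\<bar> - real n *\<^sub>R u)) \<le> norm (pprt (St.q (pprt (\<bar>x\<bar> - real n *\<^sub>R u))))"
      by (rule norm_pprt_mono)
    also have "\<dots> \<le> norm (St.q (pprt (\<bar>x\<bar> - real n *\<^sub>R u)))" by (rule norm_pprt_le)
    also have "\<dots> \<le> M * norm (pprt (\<bar>x\<bar> - real n *\<^sub>R u))" by (rule restriction_S_bound[OF t])
    also have "\<dots> \<le> (M + 1) * (\<epsilon> / (M + 1))" using n M_nonneg by (intro mult_mono) auto
    finally show "\<exists>n. norm (pprt (\<bar>St.q x\<bar> - real n *\<^sub>R u)) \<le> \<epsilon>" using M_nonneg by auto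
  qed
  ultimately have "J = {0} \<or> J = UNIV" by (intro real_ideal_trivial)
  moreover have "u \<in> J" using u by (auto simp: J_def intro!: exI[of _ 1])
  ultimately have "x \<in> J" using u(3) by auto
  then show ?thesis using \<epsilon> by (simp add: J_def)
qed

text \<open>If \<open>pprt f\<close> is nonzero, its multiples absorb \<open>pprt (- f)\<close> up
  to any \<epsilon>; being disjoint from it, \<open>pprt (- f)\<close> must vanish.\<close>

lemma fixed_comparable_zero:
  assumes "p f = f"
  shows "0 \<le> f \<or> f \<le> 0"
proof (cases "pprt f = 0")
  case True
  then show ?thesis using le_pprt[of f] by simp
next
  case False
  have "norm (pprt (- f)) \<le> 0 + \<epsilon>" if "0 < \<epsilon>" for \<epsilon>
    using fixed_quasi_interior[OF fixed_pprt[OF assms] zero_le_pprt False that, of "pprt (- f)"]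
      pprt_diff_disjoint[of "pprt f" "pprt (- f)"]
    by (simp add: inf_pprt_pprt_minus)
  then have "pprt (- f) = 0" using field_le_epsilon[of "norm (pprt (- f))" 0] by simp
  then show ?thesis using le_pprt[of "- f"] by simp
qed

text \<open>Comparability of \<open>f - c *\<^sub>R u\<close> with 0 for every \<open>c\<close>
  covers the real line by two closed nonempty sets, which meet by connectedness.\<close>

lemma fixed_multiple:
  assumes u: "p u = u" "0 \<le> u" "norm u = 1" and f: "p f = f"
  shows "\<exists>c. f = c *\<^sub>R u"
proof -
  define U L where "U = {c. f \<le> c *\<^sub>R u}" and "L = {c. c *\<^sub>R u \<le> f}"
  have "closed U" "closed L"
    unfolding U_def L_def closed_sequential_limits
    by (auto intro: limit_ge_lattice[OF tendsto_scaleR[OF _ tendsto_const]]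
        limit_le_lattice[OF tendsto_scaleR[OF _ tendsto_const]])
  moreover have UL: "c \<in> U \<or> c \<in> L" for c
    using fixed_comparable_zero[of "f - c *\<^sub>R u"] f u(1)
    by (auto simp: U_def L_def P.restriction_linear)
  moreover have "norm f + 1 \<in> U"
  proof (rule ccontr)
    assume "norm f + 1 \<notin> U"
    then have "(norm f + 1) *\<^sub>R u \<le> f" using UL by (auto simp: L_def)
    then have "norm ((norm f + 1) *\<^sub>R u) \<le> norm f"
      using u by (intro norm_mono_nonneg scaleR_nonneg_nonneg) auto
    then show False using u by simp
  qed
  moreover have "- (norm f + 1) \<in> L"
  proof (rule ccontr)
    assume "- (norm f + 1) \<notin> L"
    then have "f \<le> (- (norm f + 1)) *\<^sub>R u" using UL[of "- (norm f + 1)"] unfolding U_def by blast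
    then have "(norm f + 1) *\<^sub>R u \<le> - f"
      unfolding scaleR_minus_left by (rule le_minus_iff[THEN iffD1])
    then have "norm ((norm f + 1) *\<^sub>R u) \<le> norm (- f)"
      using u by (intro norm_mono_nonneg scaleR_nonneg_nonneg) auto
    then show False using u by simp
  qed
  ultimately have "U \<inter> L \<noteq> {}"
    using connected_UNIV[where 'a = real] unfolding connected_closed by blast
  then show ?thesis by (auto simp: U_def L_def intro: order.antisym)
qed

lemma rank_one:
  obtains u \<phi> where "0 \<le> u" "norm u = 1" "\<And>a. p a = \<phi> a *\<^sub>R u" "\<phi> u = 1"
proof -
  have "\<exists>a. p a \<noteq> 0"
  proof (rule ccontr)
    assume "\<not> ?thesis"
    then have "modulus (P z) = 0" for z
      using P.modulus_operator[of z] by (intro order.antisym) simp_all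
    then show False using P_nonzero by (auto simp: modulus_zero_iff)
  qed
  then obtain a where a: "p a \<noteq> 0" by blast
  define u where "u = (1 / norm (p a)) *\<^sub>R \<bar>p a\<bar>"
  have u: "0 \<le> u" "norm u = 1" "p u = u"
    using a fixed_abs[OF p_p, of a] by (simp_all add: u_def P.restriction_linear scaleR_nonneg_nonneg)
  have "\<forall>a. \<exists>c. p a = c *\<^sub>R u" using fixed_multiple[OF u(3,1,2) p_p] by blast
  then obtain \<phi> where \<phi>: "\<And>a. p a = \<phi> a *\<^sub>R u" by metis
  moreover have "\<phi> u *\<^sub>R u = 1 *\<^sub>R u" using \<phi>[of u] u(3) by simp
  then have "\<phi> u = 1" using u(2) unfolding scaleR_cancel_right by auto
  ultimately show thesis using u that by blast
qed

end

section \<open>Approximate eigenvectors converge\<close>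

locale rank_one_generator = irreducible_generator S D B M t\<^sub>0 P K r
  for S :: "real \<Rightarrow> 'a::banach_lattice complexification \<Rightarrow> 'a complexification" and D B M t\<^sub>0 P K r +
  fixes u :: 'a and \<phi> :: "'a \<Rightarrow> real"
  assumes u_nonneg: "0 \<le> u" and u_norm: "norm u = 1"
    and p_eq: "p a = \<phi> a *\<^sub>R u" and \<phi>_u: "\<phi> u = 1"
begin

section \<open>Deviation of a modulus from its mean\<close>

lemma \<phi>_linear: "\<phi> (a + b) = \<phi> a + \<phi> b" "\<phi> (a - b) = \<phi> a - \<phi> b" "\<phi> (c *\<^sub>R a) = c * \<phi> a" "\<phi> 0 = 0"
proof -
  have cancel: "x = y" if "x *\<^sub>R u = y *\<^sub>R u" for x y
    using that u_norm unfolding scaleR_cancel_right by auto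
  show "\<phi> (a + b) = \<phi> a + \<phi> b" "\<phi> (a - b) = \<phi> a - \<phi> b" "\<phi> (c *\<^sub>R a) = c * \<phi> a" "\<phi> 0 = 0"
    by (rule cancel, simp add: P.restriction_linear scaleR_left_distrib scaleR_left_diff_distrib flip: p_eq scaleR_scaleR)+
qed

lemma \<phi>_sum: "finite N \<Longrightarrow> \<phi> (\<Sum>c\<in>N. f c) = (\<Sum>c\<in>N. \<phi> (f c))"
  by (induction N rule: finite_induct) (simp_all add: \<phi>_linear)

lemma \<phi>_nonneg: "0 \<le> a \<Longrightarrow> 0 \<le> \<phi> a"
proof (rule ccontr)
  assume a: "0 \<le> a" and neg: "\<not> 0 \<le> \<phi> a"
  have "0 \<le> \<phi> a *\<^sub>R u" using P.restriction_nonneg[OF a] by (simp add: p_eq)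
  moreover have "\<phi> a *\<^sub>R u \<le> 0" using neg u_nonneg by (intro scaleR_nonpos_nonneg) auto
  ultimately have "\<phi> a *\<^sub>R u = 0" by (rule order.antisym[rotated])
  then show False using neg u_norm by auto
qed

lemma \<phi>_mono: "a \<le> b \<Longrightarrow> \<phi> a \<le> \<phi> b"
  using \<phi>_nonneg[of "b - a"] by (simp add: \<phi>_linear)

lemma \<phi>_bound: "\<phi> a \<le> onorm P * norm a"
  using P.restriction_bound[of a] by (simp add: p_eq u_norm)

lemma onorm_P_nonneg: "0 \<le> onorm P"
  using bounded_clinearD(8)[OF P_clinear] by (rule onorm_pos_le)

text \<open>Only the excess over the mean is measured, because domination by the semigroup gives no
  lower bound in norm.\<close>

definition defect :: "'a complexification \<Rightarrow> real" where
  "defect w = norm (pprt (modulus w - \<phi> (modulus w) *\<^sub>R u))"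

lemma norm_le_defect: "norm w \<le> \<phi> (modulus w) + defect w"
proof -
  define v where "v = modulus w"
  have v: "0 \<le> v" "0 \<le> \<phi> v" using \<phi>_nonneg by (simp_all add: v_def)
  have "v \<le> \<phi> v *\<^sub>R u + pprt (v - \<phi> v *\<^sub>R u)"
    using le_pprt[of "v - \<phi> v *\<^sub>R u"] by (simp add: diff_le_eq add.commute)
  then have "norm v \<le> norm (\<phi> v *\<^sub>R u + pprt (v - \<phi> v *\<^sub>R u))" using v by (intro norm_mono_nonneg)
  also have "\<dots> \<le> \<phi> v + norm (pprt (v - \<phi> v *\<^sub>R u))"
    using norm_triangle_ineq[of "\<phi> v *\<^sub>R u"] v u_norm by simp
  finally show ?thesis by (simp add: v_def defect_def norm_modulus)
qed

text \<open>
  Since \<open>\<phi>\<close> vanishes on \<open>\<bar>w\<bar> - \<phi>(\<bar>w\<bar>) u\<close>, it takes the same value on the two parts of this vector,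
  although only the positive part is known to be small in norm.
\<close>

lemma \<phi>_pprt_defect:
  "\<phi> (pprt (modulus w - \<phi> (modulus w) *\<^sub>R u)) \<le> onorm P * defect w"
  "\<phi> (pprt (\<phi> (modulus w) *\<^sub>R u - modulus w)) \<le> onorm P * defect w"
proof -
  define x where "x = modulus w - \<phi> (modulus w) *\<^sub>R u"
  show *: "\<phi> (pprt (modulus w - \<phi> (modulus w) *\<^sub>R u)) \<le> onorm P * defect w"
    using \<phi>_bound by (simp add: defect_def)
  have "\<phi> x = 0" by (simp add: x_def \<phi>_linear \<phi>_u)
  then have "\<phi> (pprt x) - \<phi> (pprt (- x)) = 0"
    using arg_cong[OF pprt_minus[of x], of \<phi>] by (simp add: \<phi>_linear)
  with * show "\<phi> (pprt (\<phi> (modulus w) *\<^sub>R u - modulus w)) \<le> onorm P * defect w"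
    by (simp add: x_def)
qed

text \<open>The error in \<open>orbit_bound\<close> grows linearly in time, so averaging costs
  \<open>M * \<delta> / \<kappa>\<close>. Hence \<open>\<kappa>\<close> is fixed first, to make the
  residue error at most \<open>\<epsilon> / 2\<close>, and \<open>\<delta>\<close> afterwards. The
  bound 4 fits differences of two \<open>normalized\<close> vectors.\<close>

lemma defect_small:
  assumes \<mu>: "Re \<mu> = 0" and \<epsilon>: "0 < \<epsilon>"
  obtains \<delta> where "0 < \<delta>"
    "\<And>w. w \<in> D \<Longrightarrow> norm w \<le> 4 \<Longrightarrow> norm (B w - \<mu> *\<^sub>C w) \<le> \<delta> \<Longrightarrow> defect w \<le> \<epsilon>"
proof -
  define \<kappa> where "\<kappa> = min (r / 2) (\<epsilon> / (2 * (K * (M * 4) + 1)))"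
  have pos: "0 < 2 * (K * (M * 4) + 1)" using K M_nonneg by (simp add: add_nonneg_pos)
  then have \<kappa>: "0 < \<kappa>" "\<kappa> < r" using r \<epsilon> by (auto simp: \<kappa>_def)
  have \<kappa>_small: "\<kappa> * (K * (M * 4)) \<le> \<epsilon> / 2"
  proof -
    have "\<kappa> * (K * (M * 4)) \<le> \<epsilon> / (2 * (K * (M * 4) + 1)) * (K * (M * 4) + 1)"
      using \<kappa> K M_nonneg by (intro mult_mono) (auto simp: \<kappa>_def)
    also have "\<dots> = \<epsilon> / 2" using pos by (simp add: field_simps)
    finally show ?thesis .
  qed
  define C where "C = M * t\<^sub>0 + M / \<kappa> + 1"
  have C: "0 < C" using M_nonneg t\<^sub>0 \<kappa> by (simp add: C_def add_nonneg_pos)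
  define \<delta> where "\<delta> = \<epsilon> / (2 * C)"
  have \<delta>: "0 < \<delta>" using \<epsilon> C by (simp add: \<delta>_def)
  have "defect w \<le> \<epsilon>" if w: "w \<in> D" "norm w \<le> 4" "norm (B w - \<mu> *\<^sub>C w) \<le> \<delta>" for w
  proof -
    define v where "v = modulus w"
    define y where "y = S t\<^sub>0 (Complexify v 0)"
    define g where "g = Complexify v 0"
    interpret S0: positive_operator "S t\<^sub>0" by (rule S_positive_operator) simp
    have orbit: "norm (pprt (- re_part (S t y - g))) \<le> M * t\<^sub>0 * \<delta> + M * \<delta> * t" if t: "0 \<le> t" for t
    proof -
      define T where "T = t + t\<^sub>0"
      have T: "t\<^sub>0 \<le> T" "0 \<le> T" using t t\<^sub>0 by (auto simp: T_def)
      interpret ST: positive_operator "S T" by (rule S_positive_operator[OF T(1)])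
      define e where "e = S T w - exp (\<mu> * T) *\<^sub>C w"
      have "norm e \<le> M * T * norm (B w - \<mu> *\<^sub>C w)"
        unfolding e_def by (rule orbit_bound[OF w(1) T(2) \<mu>])
      also have "\<dots> \<le> M * T * \<delta>" using w(3) M_nonneg T by (intro mult_left_mono) auto
      finally have e: "norm e \<le> M * T * \<delta>" .
      \<comment> \<open>The exponential is unimodular, so \<open>v\<close> is the modulus of
        \<open>S T w - e\<close>, which positivity bounds by \<open>ST.q v\<close> plus
        \<open>modulus e\<close>.\<close>
      have "v = modulus (exp (\<mu> * T) *\<^sub>C w)" by (simp add: v_def modulus_scaleC \<mu>)
      also have "exp (\<mu> * T) *\<^sub>C w = S T w + (- e)" by (simp add: e_def)
      also have "modulus (S T w + (- e)) \<le> modulus (S T w) + modulus e"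
        using modulus_add[of "S T w" "- e"] by (simp add: modulus_minus)
      also have "modulus (S T w) \<le> ST.q v" unfolding v_def by (rule ST.modulus_operator)
      finally have "v - ST.q v \<le> modulus e" by (simp add: diff_le_eq add.commute)
      then have "norm (pprt (v - ST.q v)) \<le> norm (pprt (modulus e))" by (rule norm_pprt_mono)
      also have "\<dots> = norm e" by (simp add: norm_modulus)
      also note e
      finally have bound: "norm (pprt (v - ST.q v)) \<le> M * T * \<delta>" .
      have "S t y = S T g" unfolding y_def T_def g_def using t t\<^sub>0 by (simp add: S_add)
      then have "- re_part (S t y - g) = v - ST.q v" by (simp add: g_def ST.operator_real)
      then show ?thesis using bound by (simp only: T_def) (simp add: algebra_simps)
    qed
    have "norm y \<le> M * norm w"
      using S_bound[OF t\<^sub>0, of "Complexify v 0"]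
      by (simp add: y_def norm_Complexify_real v_def norm_modulus)
    also have "\<dots> \<le> M * 4" using w(2) M_nonneg by (intro mult_left_mono)
    finally have "\<kappa> * (K * norm y) \<le> \<kappa> * (K * (M * 4))"
      using \<kappa> K by (intro mult_left_mono) auto
    then have y: "\<kappa> * (K * norm y) \<le> \<epsilon> / 2" using \<kappa>_small by simp
    have "P y = Complexify (\<phi> v *\<^sub>R u) 0"
      unfolding y_def P_S[OF t\<^sub>0] by (simp add: P.operator_real p_eq)
    then have "defect w = norm (pprt (- re_part (P y - g)))"
      by (simp add: g_def defect_def v_def)
    also have "\<dots> \<le> M * t\<^sub>0 * \<delta> + M * \<delta> / \<kappa> + \<kappa> * (K * norm y)"
      using M_nonneg \<delta> orbit
      by (intro residue_sublinear_bound[of "\<lambda>z. norm (pprt (- re_part z))", OF sublinear_parts(1-3) _ _ \<kappa>]) auto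
    also have "M * t\<^sub>0 * \<delta> + M * \<delta> / \<kappa> = (C - 1) * \<delta>" by (simp add: C_def algebra_simps)
    also have "\<dots> \<le> C * \<delta>" using \<delta> by simp
    also have "C * \<delta> = \<epsilon> / 2" using C by (simp add: \<delta>_def)
    finally show ?thesis using y by simp
  qed
  with \<delta> show thesis by (rule that)
qed

text \<open>Fixing the mean rather than the norm makes the moduli of all good approximate
  eigenvectors close to the same vector \<open>u\<close>, as measured by
  \<open>\<phi>\<close>.\<close>

definition normalized :: "'a complexification \<Rightarrow> bool" where
  "normalized z \<longleftrightarrow> z \<in> D \<and> \<phi> (modulus z) = 1 \<and> norm z \<le> 2"

lemma alignment:
  assumes \<mu>: "Re \<mu> = 0" and \<epsilon>: "0 < \<epsilon>"
  obtains \<delta> where "0 < \<delta>"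
    "\<And>z w. normalized z \<Longrightarrow> normalized w \<Longrightarrow> norm (B z - \<mu> *\<^sub>C z) \<le> \<delta> \<Longrightarrow>
      norm (B w - \<mu> *\<^sub>C w) \<le> \<delta> \<Longrightarrow> \<exists>c. cmod c = 1 \<and> norm (z - c *\<^sub>C w) \<le> \<epsilon>"
proof -
  \<comment> \<open>\<open>\<phi> (\<tau> *\<^sub>R (X + Y))\<close> is \<open>2 * \<tau>\<close>,
    half of \<open>\<epsilon>\<close>. The net depends on \<open>\<tau>\<close> alone, so its size
    is known when \<open>\<sigma>\<close> and \<open>\<delta>\<close> are chosen.\<close>
  define \<tau> where "\<tau> = \<epsilon> / 4"
  have "0 < \<tau>" using \<epsilon> by (simp add: \<tau>_def)
  then obtain N where N: "finite N" "N \<noteq> {}" "\<And>c. c \<in> N \<Longrightarrow> cmod c = 1"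
    "\<And>(z :: 'a complexification) w h. (\<And>c. c \<in> N \<Longrightarrow> h \<le> modulus (z - c *\<^sub>C w)) \<Longrightarrow>
      h \<le> \<bar>modulus z - modulus w\<bar> + \<tau> *\<^sub>R (modulus z + modulus w)"
    using finite_alignment[of \<tau>] by blast
  \<comment> \<open>\<open>card N\<close> pays for the shortfalls summed in \<open>Q\<close>, 4 for
    \<open>\<phi> \<bar>X - Y\<bar>\<close>, and 1 for the defect of the difference finally
    selected.\<close>
  define C where "C = (real (card N) + 4) * onorm P + 1"
  have C: "0 < C" using onorm_P_nonneg by (simp add: C_def add_nonneg_pos)
  define \<sigma> where "\<sigma> = \<epsilon> / (2 * C)"
  have \<sigma>: "0 < \<sigma>" "C * \<sigma> = \<epsilon> / 2" using \<epsilon> C by (simp_all add: \<sigma>_def)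
  obtain \<delta> where \<delta>: "0 < \<delta>"
    "\<And>w. w \<in> D \<Longrightarrow> norm w \<le> 4 \<Longrightarrow> norm (B w - \<mu> *\<^sub>C w) \<le> \<delta> \<Longrightarrow> defect w \<le> \<sigma>"
    using defect_small[OF \<mu> \<sigma>(1)] by blast
  show thesis
  proof (rule that[of "\<delta> / 2"])
    show "0 < \<delta> / 2" using \<delta> by simp
    fix z w
    assume z: "normalized z" "norm (B z - \<mu> *\<^sub>C z) \<le> \<delta> / 2"
      and w: "normalized w" "norm (B w - \<mu> *\<^sub>C w) \<le> \<delta> / 2"
    note nz = z(1)[unfolded normalized_def] and nw = w(1)[unfolded normalized_def]
    define v where "v c = z - c *\<^sub>C w" for c
    define X Y where "X = modulus z" and "Y = modulus w"
    have bound: "onorm P * defect x \<le> onorm P * \<sigma>" if "defect x \<le> \<sigma>" for x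
      using that onorm_P_nonneg by (rule mult_left_mono)
    have v: "defect (v c) \<le> \<sigma>" if "c \<in> N" for c
    proof (rule \<delta>(2))
      have c: "cmod c = 1" using N(3) that by simp
      show "v c \<in> D" using nz nw by (simp add: v_def generator_diff generator_scaleC)
      show "norm (v c) \<le> 4"
        using norm_triangle_ineq4[of z "c *\<^sub>C w"] nz nw c by (simp add: v_def norm_scaleC)
      have "B (v c) - \<mu> *\<^sub>C v c = (B z - \<mu> *\<^sub>C z) - c *\<^sub>C (B w - \<mu> *\<^sub>C w)"
        using nz nw by (simp add: v_def generator_diff generator_scaleC scaleC_diff_right scaleC_scaleC mult.commute)
      then show "norm (B (v c) - \<mu> *\<^sub>C v c) \<le> \<delta>"
        using norm_triangle_ineq4[of "B z - \<mu> *\<^sub>C z" "c *\<^sub>C (B w - \<mu> *\<^sub>C w)"] z(2) w(2) c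
        by (simp add: norm_scaleC)
    qed
    \<comment> \<open>Each \<open>modulus (v c)\<close> is almost a constant multiple of
      \<open>u\<close>, at least \<open>a *\<^sub>R u\<close>. Subtracting all shortfalls at once
      gives a common lower bound for the moduli, which is what \<open>N(4)\<close> takes as
      \<open>h\<close>.\<close>
    define a where "a = Min ((\<lambda>c. \<phi> (modulus (v c))) ` N)"
    define Q where "Q = (\<Sum>c\<in>N. pprt (\<phi> (modulus (v c)) *\<^sub>R u - modulus (v c)))"
    have "a *\<^sub>R u - Q \<le> \<bar>X - Y\<bar> + \<tau> *\<^sub>R (X + Y)"
      unfolding X_def Y_def
    proof (rule N(4), fold v_def)
      fix c assume c: "c \<in> N"
      have "a *\<^sub>R u \<le> \<phi> (modulus (v c)) *\<^sub>R u"
        using N(1) c u_nonneg by (intro scaleR_right_mono) (auto simp: a_def)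
      also have "\<dots> \<le> modulus (v c) + pprt (\<phi> (modulus (v c)) *\<^sub>R u - modulus (v c))"
        using le_pprt[of "\<phi> (modulus (v c)) *\<^sub>R u - modulus (v c)"] by (simp add: diff_le_eq add.commute)
      also have "pprt (\<phi> (modulus (v c)) *\<^sub>R u - modulus (v c)) \<le> Q"
        unfolding Q_def sum.remove[OF N(1) c] by (simp add: sum_nonneg)
      finally show "a *\<^sub>R u - Q \<le> modulus (v c)" by (simp add: diff_le_eq)
    qed
    from \<phi>_mono[OF this] have "a - \<phi> Q \<le> \<phi> \<bar>X - Y\<bar> + 2 * \<tau>"
      using nz nw by (simp add: \<phi>_linear \<phi>_u X_def Y_def)
    moreover have "\<phi> Q \<le> real (card N) * (onorm P * \<sigma>)"
      unfolding Q_def \<phi>_sum[OF N(1)]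
      by (intro sum_bounded_above order.trans[OF \<phi>_pprt_defect(2) bound] v)
    moreover have "\<phi> \<bar>X - Y\<bar> \<le> 4 * (onorm P * \<sigma>)"
    proof -
      have abs: "\<phi> \<bar>modulus x - u\<bar> \<le> 2 * (onorm P * \<sigma>)"
        if "normalized x" "norm (B x - \<mu> *\<^sub>C x) \<le> \<delta> / 2" for x
      proof -
        have "defect x \<le> \<sigma>" using that \<delta> by (intro \<delta>(2)) (auto simp: normalized_def)
        then show ?thesis
          using \<phi>_pprt_defect[of x] bound[of x] that(1)
          by (simp add: abs_eq_pprt[of "modulus x - u"] \<phi>_linear normalized_def)
      qed
      have "\<bar>X - Y\<bar> \<le> \<bar>X - u\<bar> + \<bar>Y - u\<bar>"
        using abs_triangle_ineq4[of "X - u" "Y - u"] by simp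
      from \<phi>_mono[OF this] abs[OF z] abs[OF w] show ?thesis by (simp add: \<phi>_linear X_def Y_def)
    qed
    ultimately have a: "a + \<sigma> \<le> \<epsilon>"
      using \<sigma>(2) \<epsilon> by (simp add: C_def \<tau>_def algebra_simps)
    have "a \<in> (\<lambda>c. \<phi> (modulus (v c))) ` N" unfolding a_def using N(1,2) by (intro Min_in) auto
    then obtain c where c: "c \<in> N" "a = \<phi> (modulus (v c))" by blast
    then have "norm (v c) \<le> \<epsilon>" using norm_le_defect[of "v c"] v[OF c(1)] a by simp
    then show "\<exists>c. cmod c = 1 \<and> norm (z - c *\<^sub>C w) \<le> \<epsilon>" using N(3) c(1) v_def by auto
  qed
qed

lemma normalized_approximate_eigenvector:
  assumes \<mu>: "Re \<mu> = 0"
    and approx: "\<And>\<delta>. 0 < \<delta> \<Longrightarrow> \<exists>z\<in>D. norm z = 1 \<and> norm (B z - \<mu> *\<^sub>C z) \<le> \<delta>"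
    and \<delta>: "0 < \<delta>"
  obtains z where "normalized z" "norm (B z - \<mu> *\<^sub>C z) \<le> \<delta>"
proof -
  \<comment> \<open>Defect at most 1/2 forces the mean of a unit vector to be at least 1/2, so
    normalizing at most doubles the vector and its error; hence \<open>\<delta> / 2\<close>
    below.\<close>
  obtain \<delta>' where \<delta>': "0 < \<delta>'"
    "\<And>w. w \<in> D \<Longrightarrow> norm w \<le> 4 \<Longrightarrow> norm (B w - \<mu> *\<^sub>C w) \<le> \<delta>' \<Longrightarrow> defect w \<le> 1/2"
    using defect_small[OF \<mu>, of "1/2"] by auto
  have "0 < min \<delta>' (\<delta> / 2)" using \<delta> \<delta>' by simp
  from approx[OF this] obtain z where z: "z \<in> D" "norm z = 1" "norm (B z - \<mu> *\<^sub>C z) \<le> min \<delta>' (\<delta> / 2)"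
    by blast
  define a where "a = \<phi> (modulus z)"
  have a: "1/2 \<le> a" using norm_le_defect[of z] \<delta>'(2)[of z] z by (simp add: a_def)
  define w where "w = complex_of_real (1 / a) *\<^sub>C z"
  have w: "w \<in> D" "B w = complex_of_real (1 / a) *\<^sub>C B z"
    using generator_scaleC[OF z(1)] by (simp_all add: w_def)
  have "norm w = 1 / a" using a z by (simp add: w_def norm_scaleC norm_divide)
  moreover have "1 / a \<le> 2" using a by (simp add: field_simps)
  moreover have "\<phi> (modulus w) = 1" using a by (simp add: w_def modulus_scaleC \<phi>_linear norm_divide flip: a_def)
  ultimately have "normalized w" using w by (simp add: normalized_def)
  moreover have "norm (B w - \<mu> *\<^sub>C w) \<le> \<delta>"
  proof -
    have "B w - \<mu> *\<^sub>C w = complex_of_real (1 / a) *\<^sub>C (B z - \<mu> *\<^sub>C z)"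
      unfolding w(2) by (simp add: w_def scaleC_diff_right scaleC_scaleC mult.commute)
    then have "norm (B w - \<mu> *\<^sub>C w) = (1 / a) * norm (B z - \<mu> *\<^sub>C z)"
      using a by (simp add: norm_scaleC norm_divide)
    also have "\<dots> \<le> 2 * (\<delta> / 2)" using z(3) \<open>1 / a \<le> 2\<close> a by (intro mult_mono) auto
    finally show ?thesis by simp
  qed
  ultimately show thesis by (rule that)
qed

lemma eigenvector_exists:
  assumes \<mu>: "Re \<mu> = 0"
    and approx: "\<And>\<delta>. 0 < \<delta> \<Longrightarrow> \<exists>z\<in>D. norm z = 1 \<and> norm (B z - \<mu> *\<^sub>C z) \<le> \<delta>"
  shows "is_eigenvalue D B \<mu>"
proof -
  have "\<exists>\<delta>>0. \<forall>z w. normalized z \<longrightarrow> normalized w \<longrightarrow> norm (B z - \<mu> *\<^sub>C z) \<le> \<delta> \<longrightarrow>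
      norm (B w - \<mu> *\<^sub>C w) \<le> \<delta> \<longrightarrow> (\<exists>c. cmod c = 1 \<and> norm (z - c *\<^sub>C w) \<le> (1/2) ^ n)" for n :: nat
    by (rule alignment[OF \<mu>, of "(1/2) ^ n"]) (simp, blast)
  then obtain \<delta> where \<delta>: "\<And>n::nat. 0 < \<delta> n" "\<And>n z w. normalized z \<Longrightarrow> normalized w \<Longrightarrow>
      norm (B z - \<mu> *\<^sub>C z) \<le> \<delta> n \<Longrightarrow> norm (B w - \<mu> *\<^sub>C w) \<le> \<delta> n \<Longrightarrow>
      \<exists>c. cmod c = 1 \<and> norm (z - c *\<^sub>C w) \<le> (1/2) ^ n"
    by metis
  \<comment> \<open>\<open>\<delta> n\<close> feeds the alignment, \<open>(1/2) ^ n\<close> makes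
    the limit an exact eigenvector.\<close>
  define \<eta> where "\<eta> n = min (\<delta> n) ((1/2) ^ n)" for n
  have \<eta>: "0 < \<eta> n" "\<eta> n \<le> \<delta> n" "\<eta> n \<le> (1/2) ^ n" for n using \<delta>(1) by (simp_all add: \<eta>_def)
  define good where "good n z \<longleftrightarrow> normalized z \<and> norm (B z - \<mu> *\<^sub>C z) \<le> \<eta> n" for n z
  have base: "\<exists>z. good 0 z"
    by (rule normalized_approximate_eigenvector[OF \<mu> approx \<eta>(1)[of 0]]) (auto simp: good_def)
  have step: "\<exists>z'. good (Suc n) z' \<and> norm (z - z') \<le> (1/2) ^ n" if z: "good n z" for n z
  proof -
    \<comment> \<open>\<open>w\<close> has to meet the tolerance of \<open>n\<close> to be aligned
      with \<open>z\<close>, and the next one to continue the sequence.\<close>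
    have "0 < min (\<eta> n) (\<eta> (Suc n))" using \<eta> by simp
    with \<mu> approx obtain w where w: "normalized w" "norm (B w - \<mu> *\<^sub>C w) \<le> min (\<eta> n) (\<eta> (Suc n))"
      by (rule normalized_approximate_eigenvector)
    then obtain c where c: "cmod c = 1" "norm (z - c *\<^sub>C w) \<le> (1/2) ^ n"
      using \<delta>(2)[of z w n] z \<eta>(2)[of n] by (auto simp: good_def)
    have "B (c *\<^sub>C w) - \<mu> *\<^sub>C (c *\<^sub>C w) = c *\<^sub>C (B w - \<mu> *\<^sub>C w)"
      using w(1) by (simp add: normalized_def generator_scaleC scaleC_diff_right scaleC_scaleC mult.commute)
    then have "good (Suc n) (c *\<^sub>C w)"
      using w c by (simp add: good_def normalized_def generator_scaleC modulus_scaleC norm_scaleC)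
    with c(2) show ?thesis by blast
  qed
  from dependent_nat_choice[of good "\<lambda>n z z'. norm (z - z') \<le> (1/2) ^ n", OF base step]
  obtain f where f: "\<And>n. good n (f n)" "\<And>n. norm (f n - f (Suc n)) \<le> (1/2) ^ n" by blast
  have "summable (\<lambda>n. f (Suc n) - f n)"
    by (rule summable_comparison_test'[of "\<lambda>n. (1/2) ^ n" 0]) (auto simp: f(2) norm_minus_commute)
  from summable_LIMSEQ[OF this]
  have "(\<lambda>n. f n - f 0) \<longlonglongrightarrow> (\<Sum>n. f (Suc n) - f n)"
    by (simp add: sum_lessThan_telescope)
  from tendsto_add[OF this tendsto_const[of "f 0"]]
  obtain z where z: "f \<longlonglongrightarrow> z" by auto
  have "S t z = exp (\<mu> * t) *\<^sub>C z" if t: "0 \<le> t" for t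
  proof -
    have bound: "norm (S t (f n) - exp (\<mu> * t) *\<^sub>C f n) \<le> M * t * (1/2) ^ n" for n
    proof -
      have "norm (S t (f n) - exp (\<mu> * t) *\<^sub>C f n) \<le> M * t * norm (B (f n) - \<mu> *\<^sub>C f n)"
        using f(1)[of n] by (intro orbit_bound t \<mu>) (simp add: good_def normalized_def)
      also have "\<dots> \<le> M * t * (1/2) ^ n"
        using f(1)[of n] \<eta>(3)[of n] M_nonneg t by (intro mult_left_mono) (auto simp: good_def)
      finally show ?thesis .
    qed
    have "(\<lambda>n. norm (S t (f n) - exp (\<mu> * t) *\<^sub>C f n)) \<longlonglongrightarrow> norm (S t z - exp (\<mu> * t) *\<^sub>C z)"
      by (intro tendsto_intros z bounded_linear.tendsto[OF bounded_clinearD(8)[OF clinear[OF t]]])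
    moreover have "(\<lambda>n. M * t * (1/2) ^ n) \<longlonglongrightarrow> M * t * 0"
      by (intro tendsto_intros LIMSEQ_power_zero) simp
    ultimately have "norm (S t z - exp (\<mu> * t) *\<^sub>C z) \<le> M * t * 0"
      by (rule LIMSEQ_le) (use bound in blast)
    then show ?thesis by simp
  qed
  note z_eigen = eigenvectorI[OF this]
  \<comment> \<open>The limit is nonzero because \<open>\<phi>\<close>, which is bounded in norm,
    equals 1 on every modulus of the sequence.\<close>
  have "1 \<le> onorm P * norm (f n)" for n
    using f(1)[of n] \<phi>_bound[of "modulus (f n)"] by (simp add: good_def normalized_def norm_modulus)
  moreover have "(\<lambda>n. onorm P * norm (f n)) \<longlonglongrightarrow> onorm P * norm z" by (intro tendsto_intros z)
  ultimately have "1 \<le> onorm P * norm z" by (intro LIMSEQ_le_const) auto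
  then have "z \<noteq> 0" by auto
  with z_eigen show ?thesis by (auto simp: is_eigenvalue_def)
qed

end

section \<open>Reduction to spectral bound zero\<close>

theorem proposition4p1:
  fixes T :: "real \<Rightarrow> 'a::banach_lattice complexification \<Rightarrow> 'a complexification"
    and D :: "'a complexification set"
    and A :: "'a complexification \<Rightarrow> 'a complexification"
    and s :: real
  assumes "C0_semigroup T"
    and "is_generator D A T"
    and "real_semigroup T"
    and "uniformly_eventually_positive T"
    and "persistently_irreducible T"
    and "spectral_bound D A = ereal s"
    and "resolvent_pole D A (complex_of_real s)"
    and "bounded_semigroup (rescale s T)"
  shows "\<forall>\<mu>\<in>peripheral_spectrum D A. is_eigenvalue D A \<mu>"
proof
  fix \<mu> assume \<mu>: "\<mu> \<in> peripheral_spectrum D A"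
  define S where "S = rescale s T"
  define B where "B x = A x - s *\<^sub>R x" for x
  have S_eq: "S t x = exp (- (complex_of_real s * t)) *\<^sub>C T t x" for t x
    by (simp add: S_def rescale_def scaleR_eq_scaleC mult.commute exp_of_real[symmetric])
  \<comment> \<open>The inverse twist recovers membership in \<open>D\<close> from right derivatives
    of \<open>S\<close>, and carries invariance of ideals back to \<open>T\<close>.\<close>
  have T_eq: "T t x = exp (- (- complex_of_real s * t)) *\<^sub>C S t x" for t x
    by (simp add: S_eq scaleC_scaleC flip: exp_add)
  obtain M where M: "\<And>t. 0 \<le> t \<Longrightarrow> onorm (S t) \<le> M"
    using assms(8) unfolding bounded_semigroup_def S_def by blast
  obtain t\<^sub>0 where t\<^sub>0: "0 \<le> t\<^sub>0" "\<And>t f. t\<^sub>0 \<le> t \<Longrightarrow> nonneg f \<Longrightarrow> nonneg (T t f)"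
    using assms(4) unfolding uniformly_eventually_positive_def by blast
  have T: "\<And>t. 0 \<le> t \<Longrightarrow> bounded_clinear (T t)" "T 0 = id"
    "\<And>a b. 0 \<le> a \<Longrightarrow> 0 \<le> b \<Longrightarrow> T (a + b) = T a \<circ> T b"
    using assms(1) unfolding C0_semigroup_def by blast+
  have S_clinear: "bounded_clinear (S t)" if "0 \<le> t" for t
    using T(1)[OF that]
    by (auto simp: bounded_clinear_def S_def rescale_def scaleR_scaleC
        intro: bounded_linear_compose[OF bounded_linear_scaleR_right])
  interpret bounded_generator S D B "max 0 M"
  proof
    show "bounded_clinear (S t)" if "0 \<le> t" for t using S_clinear[OF that] .
    show "S 0 x = x" for x by (simp add: S_eq T(2))
    show "S (t + t') x = S t (S t' x)" if "0 \<le> t" "0 \<le> t'" for t t' x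
      using T(3)[OF that] bounded_clinearD(6)[OF T(1)[OF that(1)]]
      by (simp add: S_eq scaleC_scaleC algebra_simps flip: exp_add)
    show "0 \<le> max 0 M" by simp
    show "norm (S t x) \<le> max 0 M * norm x" if "0 \<le> t" for t x
      using bounded_clinearD(7)[OF S_clinear[OF that], of x] M[OF that]
      by (meson max.coboundedI2 mult_right_mono norm_ge_zero order.trans)
    show "((\<lambda>h. (S h x - x) /\<^sub>R h) \<longlongrightarrow> B x) (at_right 0)" if "x \<in> D" for x
      using difference_quotient_twist[of "\<lambda>h. T h x" x "A x" s] assms(2) that
      by (simp add: is_generator_def B_def S_eq scaleR_eq_scaleC)
    show "x \<in> D" if "((\<lambda>h. (S h x - x) /\<^sub>R h) \<longlongrightarrow> y) (at_right 0)" for x y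
      using difference_quotient_twist[OF that, of "- s"] assms(2)
      by (auto simp: is_generator_def T_eq)
  qed
  have shift: "\<nu> *\<^sub>C x - B x = (\<nu> + s) *\<^sub>C x - A x" for \<nu> x
    by (simp add: B_def scaleC_add_left scaleR_eq_scaleC)
  have resolvent_shift: "resolvent D B \<nu> = resolvent D A (\<nu> + s)"
    and resolvent_set_shift: "\<nu> \<in> resolvent_set D B \<longleftrightarrow> \<nu> + s \<in> resolvent_set D A" for \<nu>
    unfolding resolvent_set_def resolvent_def shift by simp_all
  have "resolvent_pole D B 0"
  proof -
    obtain r m U where U: "0 < r" "1 \<le> m" "\<forall>n. bounded_clinear (U n)" "U 0 \<noteq> (\<lambda>x. 0)"
      and pole: "\<forall>\<mu>. 0 < cmod (\<mu> - complex_of_real s) \<and> cmod (\<mu> - complex_of_real s) < r \<longrightarrow> \<mu> \<in> resolvent_set D A \<and>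
         (\<lambda>N. onorm (\<lambda>x. resolvent D A \<mu> x - (\<Sum>n<N. ((\<mu> - complex_of_real s) powi (int n - int m)) *\<^sub>C U n x))) \<longlonglongrightarrow> 0"
      using assms(7) unfolding resolvent_pole_def by (elim exE conjE) (rule that; assumption)
    have shifted: "\<nu> \<in> resolvent_set D B \<and>
         (\<lambda>N. onorm (\<lambda>x. resolvent D B \<nu> x - (\<Sum>n<N. ((\<nu> - 0) powi (int n - int m)) *\<^sub>C U n x))) \<longlonglongrightarrow> 0"
      if "0 < cmod (\<nu> - 0) \<and> cmod (\<nu> - 0) < r" for \<nu>
      using pole[rule_format, of "\<nu> + s"] that by (simp add: resolvent_shift resolvent_set_shift)
    show ?thesis
      unfolding resolvent_pole_def
      by (intro exI[of _ r] exI[of _ m] exI[of _ U] conjI U allI impI)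
         (erule shifted[THEN conjunct1] shifted[THEN conjunct2])+
  qed
  then obtain P K r where P: "bounded_clinear P" "P \<noteq> (\<lambda>x. 0)" "0 \<le> K" "0 < r"
    "\<forall>\<kappa> v. 0 < \<kappa> \<longrightarrow> \<kappa> < r \<longrightarrow> (\<exists>x\<in>D. \<kappa> *\<^sub>R x - B x = v)"
    "\<forall>\<kappa>. 0 < \<kappa> \<longrightarrow> \<kappa> < r \<longrightarrow> (\<forall>x\<in>D.
      norm (\<kappa> *\<^sub>R x - P (\<kappa> *\<^sub>R x - B x)) \<le> K * \<kappa> * norm (\<kappa> *\<^sub>R x - B x))"
    by (rule resolvent_simple_pole) (rule that; assumption)
  interpret irreducible_generator S D B "max 0 M" t\<^sub>0 P K r
  proof
    show "nonneg (S t f)" if "t\<^sub>0 \<le> t" "nonneg f" for t f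
      using t\<^sub>0(2)[OF that] by (simp add: S_def rescale_def nonneg_def real_part_space_def scaleR_nonneg_nonneg)
    show "I = {0} \<or> I = UNIV"
      if I: "closed I" "lattice_ideal I" and inv: "\<And>t. t\<^sub>0 \<le> t \<Longrightarrow> S t ` I \<subseteq> I" for I
    proof -
      have "T t x \<in> I" if "t\<^sub>0 \<le> t" "x \<in> I" for t x
        using inv[OF that(1)] I(2) that(2) by (auto simp: T_eq lattice_ideal_def csubspace_def)
      then show ?thesis
        using assms(5) I t\<^sub>0(1) unfolding persistently_irreducible_def by blast
    qed
  qed (use t\<^sub>0(1) P in auto)
  obtain u \<phi> where u: "0 \<le> u" "norm u = 1" "\<And>a. p a = \<phi> a *\<^sub>R u" "\<phi> u = 1"
    using rank_one by blast
  interpret rank_one_generator S D B "max 0 M" t\<^sub>0 P K r u \<phi>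
    by unfold_locales (rule u)+
  define \<nu> where "\<nu> = \<mu> - s"
  have \<mu>_spec: "\<mu> \<notin> resolvent_set D A" "Re \<mu> = s"
    using \<mu> assms(6) by (simp_all add: peripheral_spectrum_def op_spectrum_def)
  \<comment> \<open>Everything to the right of the spectral bound lies in the resolvent set, so
    \<open>\<nu>\<close> is a boundary point as \<open>approximate_eigenvector\<close>
    requires.\<close>
  have right: "\<nu> + complex_of_real \<epsilon> \<in> resolvent_set D B" if "0 < \<epsilon>" for \<epsilon>
  proof (rule ccontr)
    assume "\<nu> + complex_of_real \<epsilon> \<notin> resolvent_set D B"
    then have "\<mu> + \<epsilon> \<in> op_spectrum D A"
      by (simp add: resolvent_set_shift \<nu>_def op_spectrum_def algebra_simps)
    then have "ereal (Re (\<mu> + \<epsilon>)) \<le> spectral_bound D A"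
      unfolding spectral_bound_def by (rule SUP_upper)
    then show False using that \<mu>_spec assms(6) by simp
  qed
  have "is_eigenvalue D B \<nu>"
  proof (rule eigenvector_exists)
    show "Re \<nu> = 0" using \<mu>_spec by (simp add: \<nu>_def)
    show "\<exists>z\<in>D. norm z = 1 \<and> norm (B z - \<nu> *\<^sub>C z) \<le> \<delta>" if "0 < \<delta>" for \<delta>
      using \<mu>_spec right that by (intro approximate_eigenvector) (auto simp: resolvent_set_shift \<nu>_def)
  qed
  then show "is_eigenvalue D A \<mu>"
    by (auto simp: is_eigenvalue_def B_def \<nu>_def scaleC_diff_left scaleR_eq_scaleC)
qed

end
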